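(* Let $p>3$ be a prime and put $\Phi=(p-2)(p-3)$ and $\alpha=3(p-3)$. Then the number of conjugacy classes (under conjugation in $\mathrm{PGL}_{4}(\mathbb{C})$) of admissible cyclic subgroups of order $p$ of $\mathrm{PGL}_{4}(\mathbb{C})$ is \begin{itemize} \item $\dfrac{\alpha}{12}+\dfrac{\Phi-\alpha}{24}$ if $p\not\equiv 1 \pmod 4$ and $p\not\equiv 1\pmod 3$; \item $1+\dfrac{\alpha}{12}+\dfrac{\Phi-\alpha-8}{24}$ if $p\not\equiv 1 \pmod 4$ and $p\equiv 1\pmod 3$; \item $1+\dfrac{\alpha-6}{12}+\dfrac{\Phi-\alpha}{24}$ if $p\equiv 1 \pmod 4$ and $p\not\equiv 1\pmod 3$; \item $2+\dfrac{\alpha-6}{12}+\dfrac{\Phi-\alpha-8}{24}$ if $p\equiv 1 \pmod 4$ and $p\equiv 1\pmod 3$. \end{itemize}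
   Context: A set of points in $\mathbb{P}^k(\mathbb{C})$ is in general position if any subset of $t\le k+1$ of its points spans a $(t-1)$-dimensional linear projective subspace. The group $\mathrm{PGL}_{k+1}(\mathbb{C})$ acts on $\mathbb{P}^k(\mathbb{C})$ and hence on finite sets of points; for a finite set $T$ of points, $\mathrm{Aut}(T)=\{f\in \mathrm{PGL}_{k+1}(\mathbb{C}) : T^f=T\}$ (setwise stabilizer). A finite subgroup $H$ of $\mathrm{PGL}_{k+1}(\mathbb{C})$ is called admissible if there exists a finite set $T$ of $n\ge k+3$ distinct points of $\mathbb{P}^k(\mathbb{C})$ in general position such that $H\subseteq \mathrm{Aut}(T)$. Here $k=3$. *)

theory Defs
  imports
    "HOL-Analysis.Analysis"
    "HOL-Algebra.Coset"
    "HOL-Algebra.Group_Action"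
    "HOL-Algebra.Elementary_Groups"
    "HOL-Library.Numeral_Type"
begin

text \<open>
  Projective space of dimension \<open>k\<close> is modelled on \<open>complex ^ 'n\<close> with \<open>CARD('n) = k + 1\<close>.
  The prefix \<open>vec\<close> refers to linear algebra over the base field, here the complex numbers;
  the unprefixed \<open>subspace\<close>, \<open>dim\<close> would be those of the underlying real vector space.
\<close>

definition GL :: "(complex ^ 'n ^ 'n) monoid" where
  "GL = \<lparr>carrier = {A. invertible A}, mult = (**), one = mat 1\<rparr>"

definition scalars :: "(complex ^ 'n ^ 'n) set" where
  "scalars = {mat c | c. c \<noteq> 0}"

definition PGL :: "(complex ^ 'n ^ 'n) set monoid" where
  "PGL = GL Mod scalars"

lemma group_GL: "group (GL :: (complex ^ 'n ^ 'n) monoid)"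
proof (rule groupI)
  fix A :: "complex ^ 'n ^ 'n"
  assume "A \<in> carrier GL"
  then obtain B where "A ** B = mat 1" "B ** A = mat 1"
    by (auto simp: GL_def invertible_def)
  then show "\<exists>B\<in>carrier GL. B \<otimes>\<^bsub>GL\<^esub> A = \<one>\<^bsub>GL\<^esub>"
    by (auto simp: GL_def invertible_def)
next
  show "\<one>\<^bsub>GL\<^esub> \<in> carrier (GL :: (complex ^ 'n ^ 'n) monoid)"
    unfolding GL_def invertible_def by (auto intro: exI[of _ "mat 1"])
qed (simp_all add: GL_def invertible_mult matrix_mul_assoc[symmetric])

lemma mat_times_mat: "mat c ** (mat d :: complex ^ 'n ^ 'n) = mat (c * d)"
  by (simp add: vec_eq_iff matrix_matrix_mult_def mat_def mult_delta_left mult_delta_right)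

lemma mat_times_commute: "mat c ** A = A ** (mat c :: complex ^ 'n ^ 'n)"
  by (simp add: vec_eq_iff matrix_matrix_mult_def mat_def mult_delta_left mult_delta_right
      mult.commute)

lemma normal_scalars: "scalars \<lhd> (GL :: (complex ^ 'n ^ 'n) monoid)"
proof -
  interpret group "GL :: (complex ^ 'n ^ 'n) monoid" by (rule group_GL)
  have inv: "mat c ** mat (inverse c) = (mat 1 :: complex ^ 'n ^ 'n)"
            "mat (inverse c) ** mat c = (mat 1 :: complex ^ 'n ^ 'n)" if "c \<noteq> 0" for c
    using that by (simp_all add: mat_times_mat)
  have sub: "scalars \<subseteq> carrier (GL :: (complex ^ 'n ^ 'n) monoid)"
    using inv by (fastforce simp: scalars_def GL_def invertible_def)
  have "subgroup scalars (GL :: (complex ^ 'n ^ 'n) monoid)"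
  proof (rule subgroupI[OF sub])
    fix A :: "complex ^ 'n ^ 'n"
    assume "A \<in> scalars"
    then obtain c where c: "A = mat c" "c \<noteq> 0" by (auto simp: scalars_def)
    have "mat (inverse c) \<in> (scalars :: (complex ^ 'n ^ 'n) set)"
      using c(2) by (auto simp: scalars_def)
    moreover from this have "inv\<^bsub>GL\<^esub> A = mat (inverse c)"
      using sub c \<open>A \<in> scalars\<close> inv by (intro inv_equality) (auto simp: GL_def)
    ultimately show "inv\<^bsub>GL\<^esub> A \<in> scalars" by simp
  next
    fix A B :: "complex ^ 'n ^ 'n"
    assume "A \<in> scalars" "B \<in> scalars"
    then show "A \<otimes>\<^bsub>GL\<^esub> B \<in> scalars"
      by (fastforce simp: scalars_def GL_def mat_times_mat)
  qed (auto simp: scalars_def intro: exI[of _ 1])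
  then show ?thesis
  proof (rule normalI, intro ballI)
    fix A :: "complex ^ 'n ^ 'n"
    show "scalars #>\<^bsub>GL\<^esub> A = A <#\<^bsub>GL\<^esub> scalars"
      by (auto simp: r_coset_def l_coset_def scalars_def GL_def mat_times_commute)
  qed
qed

lemma group_PGL: "group (PGL :: (complex ^ 'n ^ 'n) set monoid)"
  unfolding PGL_def by (rule normal.factorgroup_is_group[OF normal_scalars])

definition proj_points :: "(complex ^ 'n) set set" where
  "proj_points = {L. vec.subspace L \<and> vec.dim L = 1}"

text \<open>
  An element of \<open>PGL\<close> is a coset of matrices that differ by nonzero scalars; all of them
  send a line \<open>L\<close> to the same line, which is therefore the union below.
\<close>

definition proj_act :: "(complex ^ 'n ^ 'n) set \<Rightarrow> (complex ^ 'n) set \<Rightarrow> (complex ^ 'n) set" where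
  "proj_act F L = (\<Union>A\<in>F. (*v) A ` L)"

lemma proj_act_coset:
  fixes L :: "(complex ^ 'n) set"
  assumes "vec.subspace L"
  shows "proj_act (scalars #>\<^bsub>GL\<^esub> A) L = (*v) A ` L"
proof -
  have "mat c *v x = c *s x" for c :: complex and x :: "complex ^ 'n"
    by (simp add: vec_eq_iff matrix_vector_mult_def mat_def mult_delta_left mult_delta_right)
  then have eq: "(mat c ** A) *v x = A *v (c *s x)" for c x
    by (simp add: matrix_vector_mul_assoc[symmetric] mat_times_commute)
  have 1: "(mat c ** A) *v x \<in> (*v) A ` L" if "x \<in> L" for c x
    unfolding eq using that assms by (blast intro: vec.subspace_scale)
  have coset: "scalars #>\<^bsub>GL\<^esub> A = {mat c ** A | c. c \<noteq> 0}"
    by (auto simp: r_coset_def scalars_def GL_def)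
  show ?thesis
  proof
    show "proj_act (scalars #>\<^bsub>GL\<^esub> A) L \<subseteq> (*v) A ` L"
      using 1 by (auto simp: proj_act_def coset)
    have "A \<in> scalars #>\<^bsub>GL\<^esub> A"
      unfolding coset by (rule CollectI, rule exI[of _ 1]) simp
    then show "(*v) A ` L \<subseteq> proj_act (scalars #>\<^bsub>GL\<^esub> A) L"
      unfolding proj_act_def by blast
  qed
qed

text \<open>Projective dimension \<open>t - 1\<close> of a span amounts to linear dimension \<open>t\<close>.\<close>

definition general_position :: "(complex ^ 'n) set set \<Rightarrow> bool" where
  "general_position T \<longleftrightarrow>
     T \<subseteq> proj_points \<and>
     (\<forall>S\<subseteq>T. finite S \<and> card S \<le> CARD('n) \<longrightarrow> vec.dim (vec.span (\<Union>S)) = card S)"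

definition proj_Aut :: "(complex ^ 'n) set set \<Rightarrow> (complex ^ 'n ^ 'n) set set" where
  "proj_Aut T = {f \<in> carrier PGL. proj_act f ` T = T}"

text \<open>The bound \<open>CARD('n) + 2\<close> is \<open>k + 3\<close>.\<close>

definition admissible :: "(complex ^ 'n ^ 'n) set set \<Rightarrow> bool" where
  "admissible H \<longleftrightarrow>
     subgroup H PGL \<and> finite H \<and>
     (\<exists>T. finite T \<and> CARD('n) + 2 \<le> card T \<and> general_position T \<and> H \<subseteq> proj_Aut T)"

definition subgroup_conj_class :: "('a, 'b) monoid_scheme \<Rightarrow> 'a set \<Rightarrow> 'a set set" where
  "subgroup_conj_class G H =
     orbit G (\<lambda>g. \<lambda>K\<in>{K. subgroup K G}. g <#\<^bsub>G\<^esub> K #>\<^bsub>G\<^esub> (inv\<^bsub>G\<^esub> g)) H"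

definition admissible_cyclic_classes :: "nat \<Rightarrow> (complex ^ 'n ^ 'n) set set set set" where
  "admissible_cyclic_classes m =
     subgroup_conj_class PGL `
       {H. admissible H \<and> cyclic_group (PGL\<lparr>carrier := H\<rparr>) \<and> card H = m}"

end

theory Submission
  imports Defs "HOL-Computational_Algebra.Polynomial" "HOL-Number_Theory.Number_Theory"
begin

text \<open>
  Let \<open>n = 4\<close>, or more generally let \<open>2 \<le> n < p\<close> be the size of the matrices, and let
  \<open>\<zeta>\<close> be a primitive \<open>p\<close>-th root of unity. An \<open>n\<close>-element set \<open>S\<close> of residues modulo \<open>p\<close>
  gives the subgroup generated by the diagonal matrix with the entries \<open>\<zeta>\<^sup>s\<close>, \<open>s \<in> S\<close>.
  The proof shows that these subgroups represent all classes and finds when two of them are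
  conjugate, so that the classes become orbits that can be counted.

  Every class is represented (\<open>conjugate_to_std_subgroup\<close>): let \<open>H\<close> be admissible with witness
  \<open>T\<close> and let \<open>A\<close>, scaled so that \<open>A\<^sup>p = 1\<close>, represent a generator. If \<open>A\<close> fixed all points of
  \<open>T\<close>, it would fix a projective frame and hence be a scalar. So some point moves, and its orbit has
  \<open>p\<close> elements; by general position the vectors \<open>v, A v, \<dots>, A\<^bsup>n-1\<^esup> v\<close> span the space. Since \<open>v\<close> is a
  sum of eigenvectors, \<open>A\<close> needs \<open>n\<close> different eigenvalues for this.

  Every set \<open>S\<close> occurs (\<open>admissible_std_subgroup\<close>): for \<open>T\<close> take the orbit of the all-ones point
  and one coordinate point. General position says that certain minors of the Fourier matrix
  \<open>\<zeta>\<^bsup>i j\<^esup>\<close> do not vanish. For prime \<open>p\<close> this is Chebotarev's theorem, proved here in the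
  equivalent form that a nonzero polynomial of degree less than \<open>p\<close> has fewer \<open>p\<close>-th roots of unity
  as zeros than it has nonzero coefficients (\<open>chebotarev_uncertainty\<close>).

  Two such subgroups are conjugate if and only if the sets are related by an affine map
  \<open>x \<mapsto> m x + b\<close> with \<open>p\<close> not dividing \<open>m\<close>: the factor \<open>m\<close> changes the generator, the shift \<open>b\<close>
  changes the matrix by a scalar, and apart from this the spectrum is a complete invariant because
  matrices with distinct eigenvalues are diagonalizable.

  So the number of classes is the number of orbits of the affine group, of order \<open>p (p - 1)\<close>, on the
  \<open>n\<close>-element sets of residues (\<open>card_admissible_cyclic_classes\<close>). Burnside's lemma computes it for
  \<open>n = 4\<close>. The identity fixes all \<open>p choose 4\<close> sets and a translation \<open>x \<mapsto> x + b\<close> with \<open>b \<noteq> 0\<close>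
  fixes none. Every other affine map is conjugate to some \<open>x \<mapsto> m x\<close> with \<open>m \<noteq> 1\<close>, which can fix a
  set only if \<open>m\<close> has order 2, 3 or 4. There are
  \<open>(p - 1) (p - 3) / 8\<close> fixed sets for order 2, and \<open>(p - 1) / d\<close> for order \<open>d = 3\<close> or \<open>d = 4\<close>; the
  orders 3 and 4 each occur for two values of \<open>m\<close> if they divide \<open>p - 1\<close>, and otherwise not at all.
  This gives \<open>(p - 2) (p - 3) / 24 + (p - 3) / 8\<close> orbits, plus \<open>2 / 3\<close> if 3 divides \<open>p - 1\<close>, plus
  \<open>1 / 2\<close> if 4 divides \<open>p - 1\<close>, which is the claim.
\<close>

hide_const (open) up_ring.coeff up_ring.monom module.smult

section \<open>Chebotarev's theorem on the roots of sparse polynomials\<close>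

text \<open>
  Such a functional, which is automatically linear over the rationals, gives each complex number a
  rational coordinate. Denominators of these coordinates bound how often a number can be divided
  by \<open>p\<close> inside a suitable module.
\<close>

lemma exists_additive_rat_functional:
  fixes c :: complex
  assumes "c \<noteq> 0"
  shows "\<exists>\<phi> :: complex \<Rightarrow> rat. (\<forall>x y. \<phi> (x + y) = \<phi> x + \<phi> y) \<and> \<phi> c = 1"
proof -
  interpret Q: vector_space_pair "\<lambda>(q :: rat) (z :: complex). of_rat q * z" "(*) :: rat \<Rightarrow> rat \<Rightarrow> rat"
    by unfold_locales (simp_all add: algebra_simps of_rat_add of_rat_mult)
  have "Q.vs1.independent {c}"
    using assms by (simp add: Q.vs1.dependent_single)
  then obtain \<phi> where "Vector_Spaces.linear (\<lambda>(q :: rat) (z :: complex). of_rat q * z) (*) \<phi>" "\<phi> c = 1"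
    using Q.linear_independent_extend[of "{c}" "\<lambda>_. 1"] by auto
  then show ?thesis
    by (auto intro!: exI[of _ \<phi>] simp: Q.linear_add)
qed

text \<open>
  \<open>M\<close> is a \<open>\<int>[\<zeta>]\<close>-submodule of the complex numbers. Modulo \<open>1 - \<zeta>\<close> all powers of \<open>\<zeta>\<close> become
  equal to 1, so that distinct zeros of a polynomial turn into a multiple zero at 1. The coefficients
  live in the module \<open>M\<close> and not in \<open>\<int>[\<zeta>]\<close>, so they may be arbitrary complex numbers.
\<close>

locale cyclotomic_module =
  fixes p :: nat and \<zeta> :: complex and M :: "complex set"
  assumes prime_p: "prime p" and root: "\<zeta> ^ p = 1" and nontrivial: "\<zeta> \<noteq> 1"
    and zero_M: "0 \<in> M"
    and add_M: "\<And>x y. x \<in> M \<Longrightarrow> y \<in> M \<Longrightarrow> x + y \<in> M"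
    and uminus_M: "\<And>x. x \<in> M \<Longrightarrow> - x \<in> M"
    and root_M: "\<And>x. x \<in> M \<Longrightarrow> \<zeta> * x \<in> M"
begin

definition N :: "complex set" where
  "N = (\<lambda>x. (1 - \<zeta>) * x) ` M"

definition M_poly :: "complex poly \<Rightarrow> bool" where
  "M_poly g \<longleftrightarrow> (\<forall>n. coeff g n \<in> M)"

text \<open>
  A multiple zero at 1 modulo \<open>(1 - \<zeta>) M\<close>, expressed by derivatives.
\<close>

definition vanishes_mod :: "nat \<Rightarrow> complex poly \<Rightarrow> bool" where
  "vanishes_mod k g \<longleftrightarrow> (\<forall>j<k. poly ((pderiv ^^ j) g) 1 \<in> N)"

lemma root_power_M: "x \<in> M \<Longrightarrow> \<zeta> ^ i * x \<in> M"
  by (induction i) (auto simp: mult.assoc root_M)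

lemma of_nat_M: "x \<in> M \<Longrightarrow> of_nat n * x \<in> M"
  by (induction n) (auto simp: algebra_simps zero_M add_M)

lemma of_int_M: "x \<in> M \<Longrightarrow> of_int n * x \<in> M"
  by (cases n) (auto simp: of_nat_M uminus_M simp del: of_nat_Suc)

lemma sum_M: "(\<And>i. i \<in> A \<Longrightarrow> f i \<in> M) \<Longrightarrow> sum f A \<in> M"
  by (induction A rule: infinite_finite_induct) (auto simp: zero_M add_M)

lemma zero_N: "0 \<in> N"
  using zero_M by (auto simp: N_def intro: image_eqI[of _ _ 0])

lemma add_N: "x \<in> N \<Longrightarrow> y \<in> N \<Longrightarrow> x + y \<in> N"
  by (auto simp: N_def image_iff) (metis add_M distrib_left)

lemma of_int_N: "x \<in> N \<Longrightarrow> of_int n * x \<in> N"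
  unfolding N_def by (auto simp: image_iff) (metis mult.left_commute of_int_M)

lemma of_nat_N: "x \<in> N \<Longrightarrow> of_nat n * x \<in> N"
  using of_int_N[of x "int n"] by simp

lemma uminus_N: "x \<in> N \<Longrightarrow> - x \<in> N"
  using of_int_N[of x "-1"] by simp

lemma diff_N: "x \<in> N \<Longrightarrow> y \<in> N \<Longrightarrow> x - y \<in> N"
  using add_N[OF _ uminus_N] by simp

lemma sum_N: "(\<And>i. i \<in> A \<Longrightarrow> f i \<in> N) \<Longrightarrow> sum f A \<in> N"
  by (induction A rule: infinite_finite_induct) (auto simp: zero_N add_N)

lemma one_minus_root_power_N:
  assumes "x \<in> M"
  shows "(1 - \<zeta> ^ i) * x \<in> N"
  using assms
proof (induction i arbitrary: x)
  case 0
  then show ?case by (simp add: zero_N)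
next
  case (Suc i)
  have "(1 - \<zeta> ^ Suc i) * x = (1 - \<zeta>) * x + (1 - \<zeta> ^ i) * (\<zeta> * x)"
    by (simp add: algebra_simps)
  then show ?case
    using Suc.IH[OF root_M[OF Suc.prems]] Suc.prems by (auto simp: N_def intro!: add_N[unfolded N_def])
qed

text \<open>
  Because \<open>1 + \<zeta> + \<dots> + \<zeta>\<^bsup>p-1\<^esup> = 0\<close>, the number \<open>p\<close> is the sum of all \<open>1 - \<zeta>\<^sup>i\<close>. Hence the quotient of
  \<open>M\<close> by \<open>(1 - \<zeta>) M\<close> is a vector space over the field with \<open>p\<close> elements.
\<close>

lemma prime_times_N:
  assumes "x \<in> M"
  shows "of_nat p * x \<in> N"
proof -
  have "(\<Sum>i<p. \<zeta> ^ i) = 0"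
    using root nontrivial by (simp add: geometric_sum)
  then have "of_nat p * x = (\<Sum>i<p. (1 - \<zeta> ^ i) * x)"
    by (simp add: sum_subtractf flip: sum_distrib_right)
  then show ?thesis
    using assms by (simp add: one_minus_root_power_N sum_N)
qed

lemma cancel_coprime_N:
  assumes "x \<in> M" "of_int k * x \<in> N" "\<not> int p dvd k"
  shows "x \<in> N"
proof -
  have "coprime k (int p)"
    using assms(3) prime_p prime_imp_coprime[of "int p" k] by (simp add: coprime_commute)
  then obtain u v where "u * k + v * int p = 1"
    by (metis bezout_int coprime_iff_gcd_eq_1)
  then have "(of_int (u * k + v * int p) :: complex) * x = x" by simp
  then have "x = of_int u * (of_int k * x) + of_int v * (of_nat p * x)"
    by (simp add: algebra_simps)
  then show ?thesis
    using assms prime_times_N by (metis add_N of_int_N)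
qed

lemma M_poly_pderiv: "M_poly g \<Longrightarrow> M_poly ((pderiv ^^ j) g)"
  by (induction j) (auto simp: M_poly_def coeff_pderiv of_nat_M simp del: of_nat_Suc)

lemma M_poly_eval_one: "M_poly g \<Longrightarrow> poly g 1 \<in> M"
  by (auto simp: M_poly_def poly_altdef intro!: sum_M)

lemma higher_pderiv_linear_mult:
  "(pderiv ^^ Suc j) ([:- y, 1:] * h) =
     [:- y, 1:] * (pderiv ^^ Suc j) h + of_nat (Suc j) * (pderiv ^^ j) (h :: complex poly)"
proof (induction j)
  case 0
  show ?case by (simp add: pderiv_mult pderiv_pCons pderiv_diff pderiv_smult)
next
  case (Suc j)
  have "(pderiv ^^ Suc (Suc j)) ([:- y, 1:] * h) = pderiv ((pderiv ^^ Suc j) ([:- y, 1:] * h))"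
    by simp
  also have "\<dots> = [:- y, 1:] * (pderiv ^^ Suc (Suc j)) h + of_nat (Suc (Suc j)) * (pderiv ^^ Suc j) h"
    unfolding Suc.IH
    by (simp add: pderiv_add pderiv_diff pderiv_smult pderiv_mult pderiv_pCons pderiv_of_nat algebra_simps)
  finally show ?case .
qed

text \<open>
  By the Leibniz rule a factor \<open>x - \<zeta>\<^sup>i\<close>, which is \<open>x - 1\<close> modulo \<open>1 - \<zeta>\<close>, raises the order of
  vanishing by one.
\<close>

lemma vanishes_mod_linear_mult:
  assumes "M_poly h" "vanishes_mod k h"
  shows "vanishes_mod (Suc k) ([:- (\<zeta> ^ i), 1:] * h)"
  unfolding vanishes_mod_def
proof (intro allI impI)
  fix j
  assume "j < Suc k"
  have 1: "(1 - \<zeta> ^ i) * poly ((pderiv ^^ j) h) 1 \<in> N" for j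
    by (intro one_minus_root_power_N M_poly_eval_one M_poly_pderiv assms)
  show "poly ((pderiv ^^ j) ([:- (\<zeta> ^ i), 1:] * h)) 1 \<in> N"
  proof (cases j)
    case 0
    then show ?thesis using 1[of 0] by (simp add: algebra_simps)
  next
    case (Suc l)
    then have "of_nat (Suc l) * poly ((pderiv ^^ l) h) 1 \<in> N"
      using assms(2) \<open>j < Suc k\<close> by (auto simp: vanishes_mod_def intro: of_nat_N simp del: of_nat_Suc)
    moreover have "poly ((pderiv ^^ Suc l) ([:- (\<zeta> ^ i), 1:] * h)) 1 =
      (1 - \<zeta> ^ i) * poly ((pderiv ^^ Suc l) h) 1 + of_nat (Suc l) * poly ((pderiv ^^ l) h) 1"
      unfolding higher_pderiv_linear_mult by (simp add: algebra_simps)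
    ultimately show ?thesis
      using 1[of "Suc l"] Suc by (metis add_N)
  qed
qed

text \<open>
  Division by a monic linear factor stays within \<open>M\<close>: the coefficients of the quotient are found
  from the top by Horner's scheme.
\<close>

lemma M_poly_synthetic_div:
  assumes "M_poly ([:- (\<zeta> ^ i), 1:] * h)"
  shows "M_poly h"
proof -
  have "coeff h (Suc (degree h) - n) \<in> M" for n
  proof (induction n)
    case 0
    then show ?case by (simp add: coeff_eq_0 zero_M)
  next
    case (Suc n)
    show ?case
    proof (cases "n \<le> degree h")
      case True
      let ?m = "degree h - n"
      have "coeff ([:- (\<zeta> ^ i), 1:] * h) (Suc ?m) = coeff h ?m - \<zeta> ^ i * coeff h (Suc ?m)"
        by simp
      then have "coeff h ?m = coeff ([:- (\<zeta> ^ i), 1:] * h) (Suc ?m) + \<zeta> ^ i * coeff h (Suc ?m)"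
        by simp
      moreover have "coeff h (Suc ?m) \<in> M"
        using Suc True by (simp add: Suc_diff_le)
      ultimately show ?thesis
        using assms by (metis M_poly_def add_M diff_Suc_Suc root_power_M)
    next
      case False
      then show ?thesis using Suc by (simp add: not_le)
    qed
  qed
  from this[of "Suc (degree h) - m" for m] show ?thesis
    unfolding M_poly_def
    by (metis coeff_eq_0 diff_diff_cancel le_Suc_eq linorder_le_less_linear zero_M)
qed

lemma vanishes_mod_if_roots:
  assumes "finite Z" "Z \<subseteq> range (\<lambda>i. \<zeta> ^ i)" "M_poly g" "\<And>z. z \<in> Z \<Longrightarrow> poly g z = 0"
  shows "vanishes_mod (card Z) g"
  using assms
proof (induction Z arbitrary: g rule: finite_induct)
  case empty
  then show ?case by (simp add: vanishes_mod_def)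
next
  case (insert y Z)
  obtain h where h: "g = [:- y, 1:] * h"
    using insert.prems(3)[of y] by (auto simp: poly_eq_0_iff_dvd elim: dvdE)
  obtain i where i: "y = \<zeta> ^ i" using insert.prems(1) by auto
  have "M_poly h"
    using insert.prems(2) M_poly_synthetic_div[of i h] unfolding h i by blast
  moreover have "poly h z = 0" if "z \<in> Z" for z
    using insert.prems(3)[of z] that insert.hyps(2) by (auto simp: h)
  ultimately have "vanishes_mod (card Z) h"
    using insert.IH insert.prems(1) by blast
  then show ?case
    using vanishes_mod_linear_mult[OF \<open>M_poly h\<close>] insert.hyps by (simp add: h i)
qed

text \<open>
  The operator \<open>g \<mapsto> x g' - t g\<close> multiplies the coefficient of \<open>x\<^sup>n\<close> by \<open>n - t\<close>. It removes the
  monomial of degree \<open>t\<close> and, by this formula, lowers the order of vanishing at 1 by at most one.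
\<close>

lemma higher_pderiv_euler:
  "(pderiv ^^ j) (pCons 0 (pderiv g) - smult t g) =
     pCons 0 ((pderiv ^^ Suc j) g) + smult (of_nat j - t) ((pderiv ^^ j) (g :: complex poly))"
proof (induction j)
  case (Suc j)
  have "(pderiv ^^ Suc j) (pCons 0 (pderiv g) - smult t g) =
      pderiv (pCons 0 ((pderiv ^^ Suc j) g) + smult (of_nat j - t) ((pderiv ^^ j) g))"
    using Suc by simp
  also have "\<dots> = pCons 0 ((pderiv ^^ Suc (Suc j)) g) + smult (of_nat (Suc j) - t) ((pderiv ^^ Suc j) g)"
    by (simp add: pderiv_add pderiv_diff pderiv_pCons pderiv_smult smult_diff_left smult_add_left)
  finally show ?case .
qed simp

text \<open>
  Modulo \<open>(1 - \<zeta>) M\<close> this is the fact that in characteristic \<open>p\<close> a polynomial of degree less than \<open>p\<close>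
  with at most \<open>k\<close> terms and a zero of order \<open>k\<close> at 1 is zero. The induction removes one term at a time with the
  operator \<open>g \<mapsto> x g' - t g\<close>; the factors \<open>n - t\<close> it introduces are invertible modulo \<open>p\<close> as both
  exponents are less than \<open>p\<close>. The value at 1 then takes care of the removed term.
\<close>

lemma coeffs_in_N_if_vanishes_mod:
  assumes "M_poly g" "degree g < p" "vanishes_mod k g" "card {n. coeff g n \<noteq> 0} \<le> k"
  shows "coeff g n \<in> N"
  using assms
proof (induction k arbitrary: g n)
  case 0
  have "finite {n. coeff g n \<noteq> 0}"
    using MOST_coeff_eq_0[of g] by (simp add: eventually_cofinite)
  then show ?case
    using 0 by (auto simp: zero_N)
next
  case (Suc k)
  show ?case
  proof (cases "\<exists>t. coeff g t \<noteq> 0")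
    case True
    then obtain t where t: "coeff g t \<noteq> 0" by blast
    define h where "h = pCons 0 (pderiv g) - smult (of_nat t) g"
    have coeff_h: "coeff h n = of_int (int n - int t) * coeff g n" for n
      by (cases n) (auto simp: h_def coeff_pderiv algebra_simps)
    have "M_poly h"
      using Suc.prems(1) by (simp add: M_poly_def coeff_h of_int_M del: of_int_diff)
    moreover have "degree h < p"
    proof -
      have "degree h \<le> degree g"
        by (rule degree_le) (simp add: coeff_h coeff_eq_0)
      then show ?thesis using Suc.prems(2) by simp
    qed
    moreover have "vanishes_mod k h"
      unfolding vanishes_mod_def
    proof (intro allI impI)
      fix j
      assume "j < k"
      then have "poly ((pderiv ^^ Suc j) g) 1 \<in> N" "poly ((pderiv ^^ j) g) 1 \<in> N"
        using Suc.prems(3) unfolding vanishes_mod_def by (meson Suc_mono less_SucI)+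
      moreover have "poly ((pderiv ^^ j) h) 1 =
        poly ((pderiv ^^ Suc j) g) 1 + of_int (int j - int t) * poly ((pderiv ^^ j) g) 1"
        unfolding h_def higher_pderiv_euler by simp
      ultimately show "poly ((pderiv ^^ j) h) 1 \<in> N"
        by (simp add: add_N of_int_N del: of_int_diff)
    qed
    moreover have "card {n. coeff h n \<noteq> 0} \<le> k"
    proof -
      have "finite {n. coeff g n \<noteq> 0}"
        using MOST_coeff_eq_0[of g] by (simp add: eventually_cofinite)
      moreover have "{n. coeff h n \<noteq> 0} = {n. coeff g n \<noteq> 0} - {t}"
        by (auto simp: coeff_h)
      ultimately show ?thesis
        using Suc.prems(4) t by simp
    qed
    ultimately have *: "coeff h n \<in> N" for n
      by (rule Suc.IH)
    have other: "coeff g n \<in> N" if "n \<noteq> t" for n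
    proof (cases "n < p \<and> t < p")
      case True
      then have "\<not> int p dvd int n - int t"
        using that by (metis mod_eq_dvd_iff mod_less of_nat_eq_iff zmod_int)
      then show ?thesis
        using cancel_coprime_N[of "coeff g n"] *[of n] Suc.prems(1)
        unfolding coeff_h M_poly_def by blast
    next
      case False
      have "t < p"
        using t Suc.prems(2) by (meson le_degree le_less_trans)
      then have "coeff g n = 0"
        using False Suc.prems(2) by (intro coeff_eq_0) auto
      then show ?thesis by (simp add: zero_N)
    qed
    moreover have "coeff g t \<in> N"
    proof -
      have "poly g 1 \<in> N"
        using Suc.prems(3) by (force simp: vanishes_mod_def)
      moreover have "poly g 1 = coeff g t + (\<Sum>n\<in>{..degree g} - {t}. coeff g n)"
        using t by (simp add: poly_altdef le_degree flip: sum.remove)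
      moreover have "(\<Sum>n\<in>{..degree g} - {t}. coeff g n) \<in> N"
        by (intro sum_N other) auto
      ultimately show ?thesis
        using diff_N[of "poly g 1" "\<Sum>n\<in>{..degree g} - {t}. coeff g n"] by simp
    qed
    ultimately show ?thesis by metis
  qed (auto simp: zero_N)
qed

text \<open>
  Once all coefficients are divisible by \<open>1 - \<zeta>\<close>, the quotient satisfies the same hypotheses, so
  the division can be repeated.
\<close>

lemma coeffs_infinitely_divisible:
  assumes "M_poly g" "degree g < p" "finite Z" "Z \<subseteq> range (\<lambda>i. \<zeta> ^ i)"
    and "\<And>z. z \<in> Z \<Longrightarrow> poly g z = 0" and "card {n. coeff g n \<noteq> 0} \<le> card Z"
  shows "\<exists>h. M_poly h \<and> g = smult ((1 - \<zeta>) ^ k) h"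
  using assms
proof (induction k arbitrary: g)
  case 0
  then show ?case by auto
next
  case (Suc k)
  define h where "h = smult (inverse (1 - \<zeta>)) g"
  have nz: "1 - \<zeta> \<noteq> 0" using nontrivial by simp
  have "coeff g n \<in> N" for n
    using Suc.prems by (intro coeffs_in_N_if_vanishes_mod[of g "card Z"] vanishes_mod_if_roots) auto
  then have "\<exists>x\<in>M. coeff g n = (1 - \<zeta>) * x" for n
    by (auto simp: N_def)
  then have "inverse (1 - \<zeta>) * coeff g n \<in> M" for n
    using nz by (metis mult.assoc left_inverse mult_1)
  then have "M_poly h"
    by (simp add: M_poly_def h_def)
  moreover have "card {n. coeff h n \<noteq> 0} = card {n. coeff g n \<noteq> 0}"
    using nz by (simp add: h_def)
  ultimately obtain f where "M_poly f" "h = smult ((1 - \<zeta>) ^ k) f"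
    using Suc.IH[of h] Suc.prems nz by (auto simp: h_def)
  moreover have "g = smult (1 - \<zeta>) h" using nz by (simp add: h_def)
  ultimately show ?case by auto
qed

text \<open>
  In the binomial expansion of \<open>(1 - \<zeta>)\<^sup>p\<close> the outer terms cancel because \<open>p\<close> is odd and
  \<open>\<zeta>\<^sup>p = 1\<close>, and all other binomial coefficients are divisible by \<open>p\<close>.
\<close>

lemma one_minus_root_power_prime:
  assumes "x \<in> M" "odd p"
  shows "\<exists>y\<in>M. (1 - \<zeta>) ^ p * x = of_nat p * y"
proof -
  let ?f = "\<lambda>k. of_nat (p choose k) * (- \<zeta>) ^ k :: complex"
  let ?g = "\<lambda>k. of_nat ((p choose k) div p) * (- \<zeta>) ^ k * x"
  have p2: "p \<ge> 2" using prime_p prime_ge_2_nat by blast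
  have "(1 - \<zeta>) ^ p = (\<Sum>k\<le>p. ?f k)"
    using binomial_ring[of "- \<zeta>" 1 p] by simp
  also have "{..p} = insert 0 (insert p {0<..<p})"
    using p2 by auto
  also have "sum ?f \<dots> = (\<Sum>k\<in>{0<..<p}. ?f k)"
    using p2 assms(2) root by simp
  finally have "(1 - \<zeta>) ^ p * x = (\<Sum>k\<in>{0<..<p}. ?f k * x)"
    by (simp add: sum_distrib_right)
  also have "\<dots> = (\<Sum>k\<in>{0<..<p}. of_nat p * ?g k)"
  proof (rule sum.cong)
    fix k
    assume "k \<in> {0<..<p}"
    then have "p dvd (p choose k)"
      using prime_p by (intro dvd_choose_prime) auto
    then have "of_nat (p choose k) = (of_nat p * of_nat ((p choose k) div p) :: complex)"
      by (metis dvd_mult_div_cancel of_nat_mult)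
    then show "?f k * x = of_nat p * ?g k" by (simp add: mult.assoc)
  qed simp
  finally have "(1 - \<zeta>) ^ p * x = of_nat p * (\<Sum>k\<in>{0<..<p}. ?g k)"
    by (simp add: sum_distrib_left)
  moreover have "?g k \<in> M" for k
  proof -
    have "?g k = of_nat ((p choose k) div p) * (of_int ((- 1) ^ k) * (\<zeta> ^ k * x))"
      by (simp add: power_minus[of \<zeta>])
    then show ?thesis
      using assms(1) by (metis of_int_M of_nat_M root_power_M)
  qed
  ultimately show ?thesis
    by (metis (no_types, lifting) sum_M)
qed

end

text \<open>
  Suppose that there are at least as many zeros as nonzero coefficients. Then the leading coefficient
  \<open>c\<close> is divisible by all powers of \<open>1 - \<zeta>\<close>, hence by all powers of \<open>p\<close>, inside any \<open>\<int>[\<zeta>]\<close>-module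
  that contains the coefficients. Choose a functional \<open>\<phi>\<close> with \<open>\<phi> c = 1\<close> and a common denominator
  \<open>D\<close> of its values at the products of coefficients with powers of \<open>\<zeta>\<close>. On the module of all \<open>z\<close>
  for which \<open>D \<phi> (\<zeta>\<^sup>i z)\<close> is always an integer, divisibility of \<open>c\<close> by \<open>p\<^sup>k\<close> makes \<open>p\<^sup>k\<close> a divisor
  of \<open>D\<close>, which is absurd for large \<open>k\<close>.
\<close>

theorem chebotarev_uncertainty:
  fixes g :: "complex poly"
  assumes p: "prime p" "odd p" and deg: "degree g < p" and "g \<noteq> 0"
    and Z: "Z \<subseteq> {z. z ^ p = 1}" and zeros: "\<And>z. z \<in> Z \<Longrightarrow> poly g z = 0"
  shows "card Z < card {n. coeff g n \<noteq> 0}"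
proof (rule ccontr)
  assume "\<not> card Z < card {n. coeff g n \<noteq> 0}"
  then have few: "card {n. coeff g n \<noteq> 0} \<le> card Z" by simp
  have p0: "p > 0" "p > 1" using p prime_gt_0_nat prime_gt_1_nat by blast+
  define \<zeta> where "\<zeta> = cis (2 * pi / real p)"
  have power: "\<zeta> ^ k = cis (2 * pi * real k / real p)" for k
    unfolding \<zeta>_def Complex.DeMoivre by (rule arg_cong[of _ _ cis]) simp
  have root: "\<zeta> ^ p = 1"
    using p0 by (simp only: power) simp
  have bij: "bij_betw (\<lambda>k. \<zeta> ^ k) {..<p} {z. z ^ p = 1}"
    unfolding power by (rule Complex.bij_betw_roots_unity[OF p0(1)])
  have nontrivial: "\<zeta> \<noteq> 1"
    using inj_onD[OF bij_betw_imp_inj_on[OF bij], of 0 1] p0 by auto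
  have "finite Z" using finite_roots_unity[of p] p0 Z by (auto intro: finite_subset)
  have range: "Z \<subseteq> range (\<lambda>k. \<zeta> ^ k)"
    using Z bij_betw_imp_surj_on[OF bij] by blast
  define c where "c = lead_coeff g"
  have "c \<noteq> 0" using \<open>g \<noteq> 0\<close> by (simp add: c_def)
  then obtain \<phi> :: "complex \<Rightarrow> rat" where
    add: "\<And>x y. \<phi> (x + y) = \<phi> x + \<phi> y" and \<phi>c: "\<phi> c = 1"
    using exists_additive_rat_functional by blast
  have \<phi>0: "\<phi> 0 = 0" using add[of 0 0] by simp
  have \<phi>_minus: "\<phi> (- x) = - \<phi> x" for x using add[of x "- x"] \<phi>0 by (simp add: add_eq_0_iff)
  have \<phi>_nat: "\<phi> (of_nat n * x) = of_nat n * \<phi> x" for n x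
    by (induction n) (auto simp: add \<phi>0 algebra_simps)
  define V where "V = (\<lambda>(i, n). \<phi> (\<zeta> ^ i * coeff g n)) ` ({..<p} \<times> {..degree g})"
  define D :: int where "D = (\<Prod>v\<in>V. snd (quotient_of v))"
  have "finite V" by (simp add: V_def)
  have "D > 0"
    unfolding D_def by (intro prod_pos ballI) (simp add: quotient_of_denom_pos')
  have DV: "of_int D * v \<in> \<int>" if "v \<in> V" for v :: rat
  proof -
    obtain a b where ab: "quotient_of v = (a, b)" by (cases "quotient_of v")
    then have "v = of_int a / of_int b" "b > 0"
      by (simp_all add: quotient_of_div quotient_of_denom_pos)
    moreover have "D = b * (\<Prod>v\<in>V - {v}. snd (quotient_of v))"
      unfolding D_def using that \<open>finite V\<close> ab by (simp add: prod.remove)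
    ultimately have "of_int D * v = of_int (a * (\<Prod>v\<in>V - {v}. snd (quotient_of v)))"
      by (simp add: field_simps)
    then show ?thesis by (metis Ints_of_int)
  qed
  define M where "M = {z. \<forall>i. of_int D * \<phi> (\<zeta> ^ i * z) \<in> \<int>}"
  interpret cyclotomic_module p \<zeta> M
  proof unfold_locales
    show "0 \<in> M" by (simp add: M_def \<phi>0)
    show "x + y \<in> M" if "x \<in> M" "y \<in> M" for x y
      using that by (simp add: M_def add distrib_left)
    show "- x \<in> M" if "x \<in> M" for x
      using that by (simp add: M_def \<phi>_minus)
    show "\<zeta> * x \<in> M" if "x \<in> M" for x
    proof -
      have "of_int D * \<phi> (\<zeta> ^ Suc i * x) \<in> \<int>" for i
        using that unfolding M_def by blast
      then show ?thesis by (simp add: M_def mult_ac)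
    qed
  qed (use p root nontrivial in auto)
  have "of_int D * \<phi> (\<zeta> ^ i * coeff g n) \<in> \<int>" for i n
  proof -
    have "\<zeta> ^ i = \<zeta> ^ (i mod p)"
      using root by (metis div_mult_mod_eq mult_1 mult.commute power_add power_mult power_one)
    moreover have "\<phi> (\<zeta> ^ (i mod p) * coeff g n) \<in> V" if "n \<le> degree g"
      unfolding V_def using that p0 by (intro image_eqI[of _ _ "(i mod p, n)"]) auto
    ultimately show "of_int D * \<phi> (\<zeta> ^ i * coeff g n) \<in> \<int>"
      using DV by (cases "n \<le> degree g") (simp_all add: coeff_eq_0 \<phi>0)
  qed
  then have "M_poly g"
    by (simp add: M_poly_def) (simp add: M_def)
  have power_p: "\<exists>y\<in>M. ((1 - \<zeta>) ^ p) ^ k * x = of_nat (p ^ k) * y" if "x \<in> M" for k x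
    using that
  proof (induction k arbitrary: x)
    case (Suc k)
    then obtain y where y: "y \<in> M" "(1 - \<zeta>) ^ p * x = of_nat p * y"
      using one_minus_root_power_prime p by blast
    then obtain z where z: "z \<in> M" "((1 - \<zeta>) ^ p) ^ k * y = of_nat (p ^ k) * z"
      using Suc.IH by blast
    have "((1 - \<zeta>) ^ p) ^ Suc k * x = of_nat p * (((1 - \<zeta>) ^ p) ^ k * y)"
      using y(2) by (simp add: mult_ac)
    then show ?case using z by (auto simp: mult.assoc)
  qed auto
  \<comment> \<open>any exponent with \<open>D < p\<^sup>k\<close> would do\<close>
  define k where "k = nat D"
  obtain h where h: "M_poly h" "g = smult ((1 - \<zeta>) ^ (p * k)) h"
    using coeffs_infinitely_divisible[OF \<open>M_poly g\<close> deg \<open>finite Z\<close> range zeros few] by blast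
  have "coeff h (degree g) \<in> M" using h(1) by (simp add: M_poly_def)
  then obtain y where y: "y \<in> M" "((1 - \<zeta>) ^ p) ^ k * coeff h (degree g) = of_nat (p ^ k) * y"
    using power_p by blast
  have "c = of_nat (p ^ k) * y"
    using y(2) by (metis c_def coeff_smult h(2) power_mult)
  then have "of_int D = of_nat (p ^ k) * (of_int D * \<phi> y)"
    using \<phi>c \<phi>_nat[of "p ^ k" y] by (metis mult.left_commute mult.right_neutral)
  moreover have "of_int D * \<phi> y \<in> \<int>"
    using y(1) unfolding M_def by (metis (mono_tags, lifting) mem_Collect_eq mult_1 power_0)
  ultimately obtain z where "of_int D = (of_int (int (p ^ k) * z) :: rat)"
    by (metis Ints_cases of_int_mult of_int_of_nat_eq)
  then have "int (p ^ k) dvd D" by (metis dvd_triv_left of_int_eq_iff)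
  then have "int (p ^ k) \<le> D"
    using \<open>D > 0\<close> by (rule zdvd_imp_le)
  then have "p ^ k \<le> k"
    using \<open>D > 0\<close> le_nat_iff[of D "p ^ k"] by (simp add: k_def)
  moreover have "k < p ^ k"
    using p0 by (simp add: power_gt_expt)
  ultimately show False by simp
qed

section \<open>Conjugacy in a group\<close>

text \<open>
  Conjugation by \<open>g\<close> is an endomorphism, so it maps the subgroup generated by \<open>f\<close> to the subgroup
  generated by the image of \<open>f\<close>.
\<close>

lemma (in group) conjugate_generate:
  assumes "g \<in> carrier G" "f \<in> carrier G"
  shows "g <# generate G {f} #> inv g = generate G {g \<otimes> f \<otimes> inv g}"
proof -
  have "group_hom G G (\<lambda>x. g \<otimes> x \<otimes> inv g)"
  proof (unfold_locales, rule homI)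
    fix x y
    assume xy: "x \<in> carrier G" "y \<in> carrier G"
    have "g \<otimes> (x \<otimes> y) \<otimes> inv g = g \<otimes> x \<otimes> (inv g \<otimes> g) \<otimes> y \<otimes> inv g"
      using assms(1) xy by (simp add: m_assoc)
    also have "\<dots> = (g \<otimes> x \<otimes> inv g) \<otimes> (g \<otimes> y \<otimes> inv g)"
      using assms(1) xy by (simp only: m_assoc m_closed inv_closed)
    finally show "g \<otimes> (x \<otimes> y) \<otimes> inv g = (g \<otimes> x \<otimes> inv g) \<otimes> (g \<otimes> y \<otimes> inv g)" .
  qed (use assms(1) in auto)
  then have "generate G ((\<lambda>x. g \<otimes> x \<otimes> inv g) ` {f}) = (\<lambda>x. g \<otimes> x \<otimes> inv g) ` generate G {f}"
    using assms(2) by (intro group_hom.generate_img) auto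
  then show ?thesis
    by (auto simp: l_coset_def r_coset_def)
qed

lemma (in group) generate_pow_prime_ord:
  assumes "f \<in> carrier G" "prime (ord f)" "\<not> ord f dvd m"
  shows "generate G {f [^] m} = generate G {f}"
proof -
  have "f [^] m \<noteq> \<one>"
    using assms by (simp add: pow_eq_id)
  moreover have "(f [^] m) [^] ord f = \<one>"
    using assms(1) by (metis nat_pow_pow mult.commute nat_pow_one pow_ord_eq_1)
  ultimately have "ord (f [^] m) = ord f"
    using assms by (metis nat_pow_closed ord_eq_1 pow_eq_id prime_nat_iff)
  moreover have "generate G {f [^] m} \<subseteq> generate G {f}"
  proof (rule generate_subgroup_incl)
    show "{f [^] m} \<subseteq> generate G {f}"
      using generate_pow[OF assms(1)] int_pow_int[of G f m, symmetric] by blast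
  qed (use assms(1) in \<open>simp add: generate_is_subgroup\<close>)
  moreover have "finite (generate G {f})"
    using generate_pow_card[OF assms(1)] prime_gt_0_nat[OF assms(2)] card_gt_0_iff by metis
  ultimately show ?thesis
    using assms(1) by (metis card_subset_eq generate_pow_card nat_pow_closed)
qed

lemma (in group_action) orbit_eq_iff:
  assumes "x \<in> E" "y \<in> E"
  shows "orbit G \<phi> x = orbit G \<phi> y \<longleftrightarrow> y \<in> orbit G \<phi> x"
proof
  assume "orbit G \<phi> x = orbit G \<phi> y"
  then show "y \<in> orbit G \<phi> x" using orbit_refl[OF assms(2)] by simp
next
  assume y: "y \<in> orbit G \<phi> x"
  then have x: "x \<in> orbit G \<phi> y" using orbit_sym assms by blast
  have mem: "z \<in> E" if "z \<in> orbit G \<phi> u" "u \<in> E" for u z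
    using that element_image by (force simp: orbit_def)
  show "orbit G \<phi> x = orbit G \<phi> y"
  proof (intro equalityI subsetI)
    fix z assume z: "z \<in> orbit G \<phi> x"
    show "z \<in> orbit G \<phi> y" by (rule orbit_trans[OF assms(2,1) mem[OF z assms(1)] x z])
  next
    fix z assume z: "z \<in> orbit G \<phi> y"
    show "z \<in> orbit G \<phi> x" by (rule orbit_trans[OF assms mem[OF z assms(2)] y z])
  qed
qed

lemma (in group) subgroup_conj_class_eq_iff:
  assumes "subgroup H G" "subgroup K G"
  shows "subgroup_conj_class G H = subgroup_conj_class G K \<longleftrightarrow>
    (\<exists>g\<in>carrier G. K = g <# H #> inv g)"
proof -
  interpret group_action G "{H. subgroup H G}" "\<lambda>g. \<lambda>H\<in>{H. subgroup H G}. g <# H #> inv g"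
    by (rule action_by_conjugation_on_subgroups_set)
  show ?thesis
    using assms orbit_eq_iff[of H K] by (auto simp: subgroup_conj_class_def orbit_def)
qed

section \<open>Matrices up to scalars\<close>

lemma mult_GL [simp]: "A \<otimes>\<^bsub>GL\<^esub> B = A ** B"
  by (simp add: GL_def)

lemma one_GL [simp]: "\<one>\<^bsub>GL\<^esub> = mat 1"
  by (simp add: GL_def)

lemma carrier_GL_iff [simp]: "A \<in> carrier GL \<longleftrightarrow> invertible A"
  by (simp add: GL_def)

interpretation GL: group "GL :: (complex ^ 'n ^ 'n) monoid"
  by (rule group_GL)

interpretation PGL: group "PGL :: (complex ^ 'n ^ 'n) set monoid"
  by (rule group_PGL)

definition pgl :: "complex ^ 'n ^ 'n \<Rightarrow> (complex ^ 'n ^ 'n) set" where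
  "pgl A = scalars #>\<^bsub>GL\<^esub> A"

lemma carrier_PGL: "carrier PGL = pgl ` {A. invertible A}"
  by (auto simp: PGL_def FactGroup_def RCOSETS_def pgl_def)

lemma pgl_in_carrier [simp]: "invertible A \<Longrightarrow> pgl A \<in> carrier PGL"
  by (simp add: carrier_PGL)

interpretation pgl: group_hom "GL :: (complex ^ 'n ^ 'n) monoid" PGL pgl
proof -
  have "(\<lambda>A. scalars #>\<^bsub>GL\<^esub> A) \<in> hom GL (PGL :: (complex ^ 'n ^ 'n) set monoid)"
    unfolding PGL_def by (rule normal.r_coset_hom_Mod[OF normal_scalars])
  moreover have "pgl = (\<lambda>A :: complex ^ 'n ^ 'n. scalars #>\<^bsub>GL\<^esub> A)"
    by (simp add: fun_eq_iff pgl_def)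
  ultimately show "group_hom (GL :: (complex ^ 'n ^ 'n) monoid) PGL pgl"
    by unfold_locales simp
qed

lemma pgl_mat_1: "pgl (mat 1 :: complex ^ 'n ^ 'n) = \<one>\<^bsub>PGL\<^esub>"
  using pgl.hom_one by simp

lemma pgl_altdef: "pgl A = {mat c ** A | c. c \<noteq> 0}"
  by (auto simp: pgl_def r_coset_def scalars_def)

lemma pgl_eq_iff: "pgl A = pgl B \<longleftrightarrow> (\<exists>c. c \<noteq> 0 \<and> A = mat c ** B)"
proof
  assume "pgl A = pgl B"
  moreover have "A \<in> pgl A"
    unfolding pgl_altdef by (rule CollectI, rule exI[of _ 1]) simp
  ultimately show "\<exists>c. c \<noteq> 0 \<and> A = mat c ** B" by (auto simp: pgl_altdef)
next
  assume "\<exists>c. c \<noteq> 0 \<and> A = mat c ** B"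
  then obtain c where c: "c \<noteq> 0" "A = mat c ** B" by blast
  have "mat d ** B = mat (d / c) ** A" "mat d ** A = mat (d * c) ** B" for d
    using c by (simp_all add: matrix_mul_assoc mat_times_mat)
  then show "pgl A = pgl B"
    using c(1) unfolding pgl_altdef by (metis (no_types, lifting) divide_eq_0_iff mult_eq_0_iff)
qed

lemma pgl_eq_one_iff: "pgl A = \<one>\<^bsub>PGL\<^esub> \<longleftrightarrow> (\<exists>c. c \<noteq> 0 \<and> A = mat c)"
  using pgl_eq_iff[of A "mat 1"] by (simp add: pgl_mat_1)

lemma mat_vector_mult: "mat c *v x = c *s (x :: complex ^ 'n)"
  by (simp add: vec_eq_iff matrix_vector_mult_def mat_def mult_delta_left mult_delta_right)

lemma matrix_vector_mult_scale: "A *v (c *s x) = c *s (A *v (x :: complex ^ 'n))"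
  by (metis mat_times_commute mat_vector_mult matrix_vector_mul_assoc)

lemma GL_pow_mult_vector: "(A [^]\<^bsub>GL\<^esub> k) *v x = ((*v) A ^^ k) (x :: complex ^ 'n)"
  by (induction k arbitrary: x) (simp_all add: funpow_swap1 flip: matrix_vector_mul_assoc)

definition diag :: "('n \<Rightarrow> complex) \<Rightarrow> complex ^ 'n ^ 'n" where
  "diag d = (\<chi> i j. if i = j then d i else 0)"

lemma diag_mult_vector_nth [simp]: "(diag d *v x) $ i = d i * x $ i"
  by (simp add: diag_def matrix_vector_mult_def mult_delta_left)

lemma diag_mult_diag: "diag d ** diag e = diag (\<lambda>i. d i * e i)"
  by (simp add: diag_def matrix_matrix_mult_def vec_eq_iff mult_delta_left)

lemma mat_eq_diag: "mat c = diag (\<lambda>_. c)"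
  by (simp add: diag_def mat_def vec_eq_iff)

lemma diag_eq_iff: "diag d = diag e \<longleftrightarrow> d = e"
proof
  assume "diag d = diag e"
  then have "diag d $ i $ i = diag e $ i $ i" for i by simp
  then show "d = e" by (simp add: diag_def fun_eq_iff)
qed simp

lemma diag_pow: "diag d [^]\<^bsub>GL\<^esub> k = diag (\<lambda>i. d i ^ k)"
  by (induction k) (simp_all add: mat_eq_diag diag_mult_diag mult.commute)

lemma invertible_diag: "(\<And>i. d i \<noteq> 0) \<Longrightarrow> invertible (diag d)"
  unfolding invertible_def
  by (rule exI[of _ "diag (\<lambda>i. inverse (d i))"]) (simp add: diag_mult_diag mat_eq_diag)

section \<open>Eigenvalues and diagonalization\<close>

definition spectrum :: "complex ^ 'n ^ 'n \<Rightarrow> complex set" where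
  "spectrum A = {\<mu>. \<exists>v. v \<noteq> 0 \<and> A *v v = \<mu> *s v}"

lemma spectrum_diag:
  fixes d :: "'n::finite \<Rightarrow> complex"
  shows "spectrum (diag d :: complex ^ 'n ^ 'n) = range d"
proof (intro equalityI subsetI)
  fix \<mu>
  assume "\<mu> \<in> spectrum (diag d)"
  then obtain v where v: "v \<noteq> 0" "diag d *v v = \<mu> *s v" by (auto simp: spectrum_def)
  then obtain i where "v $ i \<noteq> 0" by (auto simp: vec_eq_iff)
  moreover have "d i * v $ i = \<mu> * v $ i"
    using arg_cong[OF v(2), of "\<lambda>x. x $ i"] by simp
  ultimately show "\<mu> \<in> range d" by auto
next
  fix \<mu>
  assume "\<mu> \<in> range d"
  then obtain i where "\<mu> = d i" by blast
  then have "diag d *v axis i 1 = \<mu> *s axis i 1"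
    by (auto simp: vec_eq_iff axis_def)
  moreover have "axis i 1 \<noteq> (0 :: complex ^ 'n)" by (simp add: axis_eq_0_iff)
  ultimately show "\<mu> \<in> spectrum (diag d)" unfolding spectrum_def by blast
qed

lemma spectrum_scale:
  fixes A :: "complex ^ 'n ^ 'n"
  assumes c: "c \<noteq> 0"
  shows "spectrum (mat c ** A) = (*) c ` spectrum A"
proof -
  have "(mat c ** A) *v v = \<mu> *s v \<longleftrightarrow> A *v v = (\<mu> / c) *s v" for \<mu> and v :: "complex ^ 'n"
    using c by (auto simp: mat_vector_mult vec_eq_iff field_simps simp flip: matrix_vector_mul_assoc)
  then have "\<mu> \<in> spectrum (mat c ** A) \<longleftrightarrow> \<mu> / c \<in> spectrum A" for \<mu>
    by (simp add: spectrum_def)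
  moreover have "\<mu> / c \<in> spectrum A \<longleftrightarrow> \<mu> \<in> (*) c ` spectrum A" for \<mu>
    using c by (auto intro: image_eqI[of \<mu> "(*) c" "\<mu> / c"])
  ultimately show ?thesis by blast
qed

lemma spectrum_similar:
  fixes A B Q :: "complex ^ 'n ^ 'n"
  assumes "invertible Q" "A ** Q = Q ** B"
  shows "spectrum A = spectrum B"
proof -
  obtain R where R: "R ** Q = mat 1" "Q ** R = mat 1"
    using assms(1) by (auto simp: invertible_def)
  have R': "B ** R = R ** A"
    using assms(2) R by (metis matrix_mul_assoc matrix_mul_lid matrix_mul_rid)
  have *: "spectrum B \<subseteq> spectrum A" if "R ** Q = mat 1" "A ** Q = Q ** B" for A B Q R :: "complex ^ 'n ^ 'n"
  proof
    fix \<mu>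
    assume "\<mu> \<in> spectrum B"
    then obtain v where v: "v \<noteq> 0" "B *v v = \<mu> *s v" by (auto simp: spectrum_def)
    have "R *v (Q *v v) = v"
      using that(1) by (simp add: matrix_vector_mul_assoc)
    then have "Q *v v \<noteq> 0" using v(1) by auto
    moreover have "A *v (Q *v v) = \<mu> *s (Q *v v)"
      using that(2) v(2) by (metis matrix_vector_mul_assoc matrix_vector_mult_scale)
    ultimately show "\<mu> \<in> spectrum A" by (auto simp: spectrum_def)
  qed
  from *[OF R(1) assms(2)] *[OF R(2) R'] show ?thesis by blast
qed

text \<open>
  Eigenvectors for distinct eigenvalues are linearly independent. The vectors \<open>v s\<close> are allowed to
  be zero, so that coefficients of a linear combination can be absorbed into them. Applying
  \<open>A - \<mu> t\<close> removes the summand of \<open>t\<close> and rescales the others by nonzero factors.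
\<close>

lemma eigenvector_sum_zero:
  fixes A :: "complex ^ 'n ^ 'n"
  assumes "finite S" "inj_on \<mu> S" "\<And>s. s \<in> S \<Longrightarrow> A *v v s = \<mu> s *s v s" "(\<Sum>s\<in>S. v s) = 0" "s \<in> S"
  shows "v s = 0"
  using assms
proof (induction S arbitrary: v s rule: finite_induct)
  case (insert t S)
  have "A *v (\<Sum>s\<in>insert t S. v s) = (\<Sum>s\<in>insert t S. \<mu> s *s v s)"
    using insert.prems(2) by (simp add: vec.linear_sum[OF matrix_vector_mul_linear_gen] del: sum.insert)
  then have "(\<Sum>s\<in>insert t S. \<mu> s *s v s) - \<mu> t *s (\<Sum>s\<in>insert t S. v s) = 0"
    using insert.prems(3) by (simp del: sum.insert)
  then have "(\<Sum>s\<in>insert t S. (\<mu> s - \<mu> t) *s v s) = 0"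
    by (simp add: vec.scale_sum_right vec.scale_left_diff_distrib sum_subtractf del: sum.insert)
  then have sum0: "(\<Sum>s\<in>S. (\<mu> s - \<mu> t) *s v s) = 0"
    using insert.hyps by simp
  have "v s = 0" if "s \<in> S" for s
  proof -
    have "(\<mu> s - \<mu> t) *s v s = 0"
    proof (rule insert.IH[of "\<lambda>s. (\<mu> s - \<mu> t) *s v s", OF _ _ sum0 that])
      show "inj_on \<mu> S" using insert.prems(1) by simp
      show "A *v ((\<mu> s - \<mu> t) *s v s) = \<mu> s *s ((\<mu> s - \<mu> t) *s v s)" if "s \<in> S" for s
        by (simp only: matrix_vector_mult_scale insert.prems(2)[OF insertI2[OF that]]
            vector_smult_assoc mult.commute)
    qed
    moreover have "\<mu> s \<noteq> \<mu> t"
      using insert.prems(1) insert.hyps(2) that by (auto simp: inj_on_def)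
    ultimately show ?thesis by simp
  qed
  moreover from this have "v t = 0"
    using insert.prems(3) insert.hyps by simp
  ultimately show ?case using insert.prems(4) by auto
qed simp

text \<open>
  Eigenvectors for the values \<open>d i\<close> form the columns of \<open>Q\<close>, whose kernel is trivial by the
  independence of these eigenvectors.
\<close>

lemma diagonalizable_if_distinct_eigenvalues:
  fixes A :: "complex ^ 'n ^ 'n" and d :: "'n \<Rightarrow> complex"
  assumes "inj d" "range d \<subseteq> spectrum A"
  shows "\<exists>Q. invertible Q \<and> A ** Q = Q ** diag d"
proof -
  have "\<forall>i. \<exists>v. v \<noteq> 0 \<and> A *v v = d i *s v"
    using assms(2) by (auto simp: spectrum_def)
  then obtain v where v: "\<And>i. v i \<noteq> 0" "\<And>i. A *v v i = d i *s v i" by metis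
  define Q where "Q = (\<chi> r i. v i $ r)"
  have Qx: "Q *v x = (\<Sum>i\<in>UNIV. x $ i *s v i)" for x
    unfolding matrix_mult_sum by (simp add: Q_def column_def)
  have "x = 0" if "Q *v x = 0" for x
  proof -
    have xv: "x $ i *s v i = 0" for i
      using that unfolding Qx
      by (intro eigenvector_sum_zero[of UNIV d A "\<lambda>i. x $ i *s v i"])
         (simp_all add: assms(1) matrix_vector_mult_scale v(2) mult.commute)
    have "x $ i = 0" for i using v(1)[of i] xv[of i] by simp
    then show ?thesis by (simp add: vec_eq_iff)
  qed
  then have "invertible Q"
    unfolding invertible_left_inverse matrix_left_invertible_ker by blast
  moreover have "A ** Q = Q ** diag d"
  proof -
    have "(A ** Q) $ r $ i = (A *v v i) $ r" for r i
      by (simp add: Q_def matrix_matrix_mult_def matrix_vector_mult_def)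
    moreover have "(Q ** diag d) $ r $ i = (d i *s v i) $ r" for r i
      by (simp add: Q_def diag_def matrix_matrix_mult_def mult_delta_right)
    ultimately show ?thesis by (simp add: vec_eq_iff v(2))
  qed
  ultimately show ?thesis by blast
qed

section \<open>Roots of unity\<close>

text \<open>
  The power \<open>\<zeta>\<^sup>s\<close> of the primitive root of unity \<open>\<zeta> = exp (2 \<pi> i / p)\<close>, with an integer exponent
  so that residues can be subtracted.
\<close>

definition unity :: "nat \<Rightarrow> int \<Rightarrow> complex" where
  "unity p s = cis (2 * pi * of_int s / real p)"

lemma unity_nonzero [simp]: "unity p s \<noteq> 0"
  by (simp add: unity_def)

lemma unity_0 [simp]: "unity p 0 = 1"
  by (simp add: unity_def)

lemma unity_add: "unity p (s + t) = unity p s * unity p t"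
  by (simp add: unity_def cis_mult field_simps add_divide_distrib)

lemma unity_power: "unity p s ^ k = unity p (s * int k)"
  by (induction k) (simp_all add: distrib_left unity_add mult.commute)

lemma unity_eq_1_iff:
  assumes "p > 0"
  shows "unity p s = 1 \<longleftrightarrow> int p dvd s"
proof
  assume "unity p s = 1"
  then obtain k :: int where "2 * pi * of_int s / real p = 2 * pi * of_int k"
    by (auto simp: unity_def complex_eq_iff cos_one_2pi_int cos_one_sin_zero)
  then have "real_of_int s = real_of_int (k * int p)" using assms by (simp add: field_simps)
  then show "int p dvd s" by (metis dvd_triv_right of_int_eq_iff)
next
  assume "int p dvd s"
  then obtain k where "s = int p * k" by blast
  then have "2 * pi * of_int s / real p = 2 * pi * of_int k" using assms by simp
  then have "unity p s = cis (2 * pi * of_int k)" by (simp only: unity_def)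
  then show "unity p s = 1" by (simp only: cis_multiple_2pi Ints_of_int)
qed

lemma unity_eq_iff:
  assumes "p > 0"
  shows "unity p s = unity p t \<longleftrightarrow> s mod int p = t mod int p"
proof -
  have "unity p s = unity p (s - t) * unity p t" by (simp flip: unity_add)
  then have "unity p s = unity p t \<longleftrightarrow> unity p (s - t) = 1" by auto
  then show ?thesis using assms by (simp add: unity_eq_1_iff mod_eq_dvd_iff)
qed

lemma unity_mod: "p > 0 \<Longrightarrow> unity p (s mod int p) = unity p s"
  by (simp add: unity_eq_iff)

lemma unity_power_order: "p > 0 \<Longrightarrow> unity p s ^ p = 1"
  by (simp add: unity_power unity_eq_1_iff)

lemma inj_on_unity: "inj_on (unity p) {0..<int p}"
  by (rule inj_onI) (auto simp: unity_eq_iff)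

section \<open>Diagonal subgroups of prime order and their conjugacy\<close>

definition exponent_sets :: "nat \<Rightarrow> nat \<Rightarrow> int set set" where
  "exponent_sets p n = {S. S \<subseteq> {0..<int p} \<and> card S = n}"

text \<open>
  A bijection between the index type of the matrices and \<open>S\<close>, provided that the cardinalities agree.
\<close>

definition enumeration :: "int set \<Rightarrow> 'n::finite \<Rightarrow> int" where
  "enumeration S = (SOME f. bij_betw f UNIV S)"

definition std_matrix :: "nat \<Rightarrow> int set \<Rightarrow> complex ^ 'n ^ 'n" where
  "std_matrix p S = diag (\<lambda>i. unity p (enumeration S i))"

definition std_subgroup :: "nat \<Rightarrow> int set \<Rightarrow> (complex ^ 'n ^ 'n) set set" where
  "std_subgroup p S = generate PGL {pgl (std_matrix p S)}"

definition affine_mod :: "nat \<Rightarrow> int \<Rightarrow> int \<Rightarrow> int \<Rightarrow> int" where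
  "affine_mod p m b x = (m * x + b) mod int p"

lemma finite_exponent_set: "S \<in> exponent_sets p n \<Longrightarrow> finite S"
  by (auto simp: exponent_sets_def intro: finite_subset[of _ "{0..<int p}"])

lemma bij_enum:
  assumes "S \<in> exponent_sets p CARD('n)"
  shows "bij_betw (enumeration S :: 'n::finite \<Rightarrow> int) UNIV S"
proof -
  have "\<exists>f :: 'n \<Rightarrow> int. bij_betw f UNIV S"
    using assms finite_exponent_set[OF assms]
    by (intro finite_same_card_bij) (auto simp: exponent_sets_def)
  then show ?thesis unfolding enumeration_def by (rule someI_ex)
qed

lemma range_enum:
  assumes "S \<in> exponent_sets p CARD('n)"
  shows "range (\<lambda>i::'n::finite. f (enumeration S i)) = f ` S"
proof -
  have "f ` range (enumeration S :: 'n \<Rightarrow> int) = f ` S"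
    using bij_betw_imp_surj_on[OF bij_enum[OF assms]] by simp
  then show ?thesis by (simp add: image_image)
qed

lemma invertible_std [simp]: "invertible (std_matrix p S)"
  by (simp add: std_matrix_def invertible_diag)

lemma spectrum_std:
  assumes "S \<in> exponent_sets p CARD('n)"
  shows "spectrum (std_matrix p S :: complex ^ 'n ^ 'n) = unity p ` S"
  by (simp add: std_matrix_def spectrum_diag range_enum[OF assms])

lemma inj_std:
  assumes "S \<in> exponent_sets p CARD('n::finite)"
  shows "inj (\<lambda>i::'n. unity p (enumeration S i))"
proof -
  have "inj_on (unity p) S"
    using assms by (auto simp: exponent_sets_def intro: inj_on_subset[OF inj_on_unity])
  then have "inj_on (unity p \<circ> enumeration S) (UNIV :: 'n set)"
    using bij_enum[OF assms] by (intro comp_inj_on) (auto simp: bij_betw_def)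
  then show ?thesis by (simp add: o_def)
qed

lemma std_not_scalar:
  assumes "S \<in> exponent_sets p CARD('n)" "CARD('n) \<ge> 2"
  shows "std_matrix p S \<noteq> (mat c :: complex ^ 'n ^ 'n)"
proof
  assume "std_matrix p S = (mat c :: complex ^ 'n ^ 'n)"
  then have "(\<lambda>i::'n. unity p (enumeration S i)) = (\<lambda>_. c)"
    by (simp add: std_matrix_def mat_eq_diag diag_eq_iff)
  then have "i = j" for i j :: 'n
    using inj_std[OF assms(1)] by (metis injD)
  then have "(UNIV :: 'n set) \<subseteq> {undefined}" by auto
  then have "CARD('n) \<le> card {undefined :: 'n}" by (intro card_mono) auto
  then show False using assms(2) by simp
qed

lemma ord_std:
  assumes "prime p" "S \<in> exponent_sets p CARD('n)" "CARD('n) \<ge> 2"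
  shows "PGL.ord (pgl (std_matrix p S :: complex ^ 'n ^ 'n)) = p"
proof -
  let ?f = "pgl (std_matrix p S :: complex ^ 'n ^ 'n)"
  have "?f [^]\<^bsub>PGL\<^esub> p = pgl (std_matrix p S [^]\<^bsub>GL\<^esub> p)"
    by (simp add: pgl.hom_nat_pow)
  also have "\<dots> = \<one>\<^bsub>PGL\<^esub>"
    using unity_power_order[OF prime_gt_0_nat[OF assms(1)]] pgl_mat_1
    by (simp add: std_matrix_def diag_pow mat_eq_diag)
  finally have "PGL.ord ?f dvd p"
    by (simp add: PGL.pow_eq_id)
  moreover have "PGL.ord ?f \<noteq> 1"
    using PGL.ord_eq_1[of ?f] std_not_scalar[OF assms(2,3)] by (auto simp: pgl_eq_one_iff)
  ultimately show ?thesis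
    using assms(1) by (auto simp: prime_nat_iff)
qed

lemma subgroup_std: "subgroup (std_subgroup p S) PGL"
  unfolding std_subgroup_def by (rule PGL.generate_is_subgroup) simp

lemma card_std_subgroup:
  assumes "prime p" "S \<in> exponent_sets p CARD('n)" "CARD('n) \<ge> 2"
  shows "card (std_subgroup p S :: (complex ^ 'n ^ 'n) set set) = p"
  unfolding std_subgroup_def
  using PGL.generate_pow_card[of "pgl (std_matrix p S :: complex ^ 'n ^ 'n)"] ord_std[OF assms]
  by simp

text \<open>
  If \<open>Q\<close> conjugates one group to the other, then the generator for \<open>S'\<close> is the conjugate by \<open>Q\<close> of
  some power \<open>k\<close> of the generator for \<open>S\<close>, up to a scalar \<open>c\<close>. Comparing spectra gives
  \<open>\<zeta>\<^bsup>S'\<^esup> = c \<zeta>\<^bsup>k S\<^esup>\<close>. The factor \<open>c\<close> is a quotient of \<open>p\<close>-th roots of unity and hence itself some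
  \<open>\<zeta>\<^sup>b\<close>, which makes \<open>S'\<close> an affine image of \<open>S\<close>.
\<close>

lemma affine_image_if_conjugate:
  assumes p: "prime p" and n: "CARD('n) \<ge> 2"
    and S: "S \<in> exponent_sets p CARD('n)" and S': "S' \<in> exponent_sets p CARD('n)"
    and g: "g \<in> carrier PGL"
    and eq: "std_subgroup p S' = g <#\<^bsub>PGL\<^esub> (std_subgroup p S :: (complex ^ 'n ^ 'n) set set) #>\<^bsub>PGL\<^esub> inv\<^bsub>PGL\<^esub> g"
  shows "\<exists>m\<in>{1..<int p}. \<exists>b\<in>{0..<int p}. S' = affine_mod p m b ` S"
proof -
  let ?D = "std_matrix p S :: complex ^ 'n ^ 'n" and ?D' = "std_matrix p S' :: complex ^ 'n ^ 'n"
  have p0: "p > 0" using p prime_gt_0_nat by blast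
  obtain Q :: "complex ^ 'n ^ 'n" where Q: "invertible Q" "g = pgl Q"
    using g by (auto simp: carrier_PGL)
  obtain R where R: "R = inv\<^bsub>GL\<^esub> Q" "Q ** R = mat 1" "R ** Q = mat 1" "invertible R"
    using Q(1) GL.r_inv[of Q] GL.l_inv[of Q] GL.inv_closed[of Q] by auto
  have "pgl ?D' \<in> generate PGL {g \<otimes>\<^bsub>PGL\<^esub> pgl ?D \<otimes>\<^bsub>PGL\<^esub> inv\<^bsub>PGL\<^esub> g}"
    using eq g PGL.conjugate_generate[of g "pgl ?D"] generate.incl[of "pgl ?D'" "{pgl ?D'}" PGL]
    by (simp add: std_subgroup_def)
  also have "g \<otimes>\<^bsub>PGL\<^esub> pgl ?D \<otimes>\<^bsub>PGL\<^esub> inv\<^bsub>PGL\<^esub> g = pgl (Q ** ?D ** R)"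
    using Q R pgl.hom_mult[of Q ?D] pgl.hom_mult[of "Q ** ?D" R] pgl.hom_inv[of Q]
    by (simp add: invertible_mult)
  finally have mem: "pgl ?D' \<in> generate PGL {pgl (Q ** ?D ** R)}" .
  have inv: "invertible (Q ** ?D ** R)"
    using Q R by (simp add: invertible_mult)
  have pow: "(Q ** ?D ** R) [^]\<^bsub>GL\<^esub> k = Q ** (?D [^]\<^bsub>GL\<^esub> k) ** R" for k :: nat
  proof (induction k)
    case 0
    then show ?case using R(2) by simp
  next
    case (Suc k)
    have "(Q ** ?D ** R) [^]\<^bsub>GL\<^esub> Suc k = Q ** (?D [^]\<^bsub>GL\<^esub> k) ** (R ** Q) ** ?D ** R"
      using Suc by (simp add: matrix_mul_assoc)
    then show ?case by (simp add: R(3) matrix_mul_assoc)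
  qed
  have "finite (generate PGL {pgl (Q ** ?D ** R)})"
    using card_std_subgroup[OF p S' n] p0 eq PGL.conjugate_generate[of g "pgl ?D"] g
      \<open>g \<otimes>\<^bsub>PGL\<^esub> pgl ?D \<otimes>\<^bsub>PGL\<^esub> inv\<^bsub>PGL\<^esub> g = pgl (Q ** ?D ** R)\<close>
    by (metis card_gt_0_iff invertible_std pgl_in_carrier std_subgroup_def)
  then have "PGL.ord (pgl (Q ** ?D ** R)) \<noteq> 0"
    using PGL.generate_pow_card[of "pgl (Q ** ?D ** R)"] inv mem by (metis card_0_eq empty_iff pgl_in_carrier)
  then obtain k :: nat where "pgl ?D' = pgl (Q ** ?D ** R) [^]\<^bsub>PGL\<^esub> k"
    using mem PGL.generate_pow_nat[of "pgl (Q ** ?D ** R)"] inv by auto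
  then have "pgl ?D' = pgl (Q ** (?D [^]\<^bsub>GL\<^esub> k) ** R)"
    using inv by (simp add: pow flip: pgl.hom_nat_pow)
  then obtain c where c: "c \<noteq> 0" "?D' = mat c ** (Q ** (?D [^]\<^bsub>GL\<^esub> k) ** R)"
    by (auto simp: pgl_eq_iff)
  have "spectrum (Q ** (?D [^]\<^bsub>GL\<^esub> k) ** R) = spectrum (?D [^]\<^bsub>GL\<^esub> k)"
    using Q(1) R(3) by (intro spectrum_similar[of Q]) (simp_all flip: matrix_mul_assoc)
  also have "\<dots> = range (\<lambda>i::'n. unity p (enumeration S i * int k))"
    by (simp add: std_matrix_def diag_pow spectrum_diag unity_power)
  also have "\<dots> = (\<lambda>s. unity p (s * int k)) ` S"
    by (rule range_enum[OF S])
  finally have spec: "unity p ` S' = (\<lambda>s. c * unity p (s * int k)) ` S"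
    using spectrum_std[OF S'] spectrum_scale[OF c(1), of "Q ** (?D [^]\<^bsub>GL\<^esub> k) ** R"] c(2)
    by (simp add: image_image)
  have "S \<noteq> {}" using S n by (auto simp: exponent_sets_def)
  then obtain s0 where s0: "s0 \<in> S" by blast
  then obtain t0 where t0: "c * unity p (s0 * int k) = unity p t0"
    using spec by blast
  define m where "m = int k mod int p"
  define b where "b = (t0 - s0 * int k) mod int p"
  have "unity p t0 = unity p (t0 - s0 * int k) * unity p (s0 * int k)"
    by (simp flip: unity_add)
  then have c_eq: "c = unity p (t0 - s0 * int k)"
    using t0 by (metis mult_right_cancel unity_nonzero)
  have aff: "unity p (affine_mod p m b s) = c * unity p (s * int k)" for s
  proof -
    have "affine_mod p m b s = (int k * s + (t0 - s0 * int k)) mod int p"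
      unfolding affine_mod_def m_def b_def
      by (rule mod_add_cong, rule mod_mult_cong) simp_all
    then have "affine_mod p m b s = (t0 - s0 * int k + s * int k) mod int p"
      by (simp add: algebra_simps)
    then show ?thesis
      by (simp only: unity_mod[OF p0] c_eq unity_add)
  qed
  have same: "unity p ` S' = unity p ` (affine_mod p m b ` S)"
    by (simp add: spec image_image aff)
  have sub: "S' \<subseteq> {0..<int p}" "affine_mod p m b ` S \<subseteq> {0..<int p}"
    using S' p0 by (auto simp: exponent_sets_def affine_mod_def)
  have S'_eq: "S' = affine_mod p m b ` S"
    by (rule iffD1[OF inj_on_image_eq_iff[OF inj_on_unity sub] same])
  \<comment> \<open>a constant map cannot have an image with at least two elements\<close>
  moreover have "m \<noteq> 0"
  proof
    assume "m = 0"
    then have "S' \<subseteq> {b mod int p}" using S'_eq by (auto simp: affine_mod_def)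
    then have "card S' \<le> card {b mod int p}" by (intro card_mono) auto
    then show False using S' n by (simp add: exponent_sets_def)
  qed
  moreover have "0 \<le> m" "m < int p" "b \<in> {0..<int p}"
    using p0 by (auto simp: m_def b_def)
  ultimately show ?thesis by (intro bexI[of _ m] bexI[of _ b]) auto
qed

text \<open>
  The \<open>m\<close>-th power of the generator for \<open>S\<close>, multiplied by the scalar \<open>\<zeta>\<^sup>b\<close>, has the same distinct
  eigenvalues as the generator for \<open>S'\<close>. So these two matrices are similar, and since \<open>p\<close> does not
  divide \<open>m\<close> the power generates the same group.
\<close>

lemma conjugate_if_affine_image:
  assumes p: "prime p" and n: "CARD('n) \<ge> 2"
    and S: "S \<in> exponent_sets p CARD('n)" and S': "S' \<in> exponent_sets p CARD('n)"
    and m: "m \<in> {1..<int p}" and eq: "S' = affine_mod p m b ` S"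
  shows "\<exists>g\<in>carrier PGL. (std_subgroup p S :: (complex ^ 'n ^ 'n) set set) =
    g <#\<^bsub>PGL\<^esub> std_subgroup p S' #>\<^bsub>PGL\<^esub> inv\<^bsub>PGL\<^esub> g"
proof -
  let ?D = "std_matrix p S :: complex ^ 'n ^ 'n" and ?D' = "std_matrix p S' :: complex ^ 'n ^ 'n"
  have p0: "p > 0" using p prime_gt_0_nat by blast
  let ?M = "mat (unity p b) ** (?D [^]\<^bsub>GL\<^esub> nat m)"
  have "spectrum ?M = (\<lambda>s. unity p b * unity p (s * m)) ` S"
    using m range_enum[OF S, of "\<lambda>s. unity p b * unity p (s * m)"]
    by (simp add: spectrum_scale std_matrix_def diag_pow spectrum_diag unity_power image_image)
  also have "\<dots> = unity p ` S'"
    unfolding eq image_image affine_mod_def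
    by (simp add: unity_mod p0 unity_add mult.commute)
  finally have "range (\<lambda>i::'n. unity p (enumeration S' i)) \<subseteq> spectrum ?M"
    using spectrum_std[OF S'] by (simp add: std_matrix_def spectrum_diag)
  then obtain Q where Q: "invertible Q" "?M ** Q = Q ** ?D'"
    using diagonalizable_if_distinct_eigenvalues[OF inj_std[OF S'], of ?M]
    by (auto simp: std_matrix_def)
  obtain R where R: "R = inv\<^bsub>GL\<^esub> Q" "Q ** R = mat 1" "R ** Q = mat 1" "invertible R"
    using Q(1) GL.r_inv[of Q] GL.l_inv[of Q] GL.inv_closed[of Q] by auto
  have "?M = Q ** ?D' ** R"
    using Q(2) R(2) by (metis matrix_mul_assoc matrix_mul_rid)
  have "pgl ?D [^]\<^bsub>PGL\<^esub> nat m = pgl (?D [^]\<^bsub>GL\<^esub> nat m)"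
    by (simp add: pgl.hom_nat_pow)
  also have "\<dots> = pgl ?M"
    unfolding pgl_eq_iff
    by (rule exI[of _ "inverse (unity p b)"]) (simp add: matrix_mul_assoc mat_times_mat)
  also have "\<dots> = pgl Q \<otimes>\<^bsub>PGL\<^esub> pgl ?D' \<otimes>\<^bsub>PGL\<^esub> inv\<^bsub>PGL\<^esub> pgl Q"
    using Q R pgl.hom_mult[of Q ?D'] pgl.hom_mult[of "Q ** ?D'" R] pgl.hom_inv[of Q]
    unfolding \<open>?M = Q ** ?D' ** R\<close> by (simp add: invertible_mult)
  finally have conj: "pgl ?D [^]\<^bsub>PGL\<^esub> nat m = pgl Q \<otimes>\<^bsub>PGL\<^esub> pgl ?D' \<otimes>\<^bsub>PGL\<^esub> inv\<^bsub>PGL\<^esub> pgl Q" .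
  have "\<not> p dvd nat m"
    using m by (auto dest!: dvd_imp_le)
  then have "generate PGL {pgl ?D [^]\<^bsub>PGL\<^esub> nat m} = std_subgroup p S"
    unfolding std_subgroup_def using p ord_std[OF p S n]
    by (intro PGL.generate_pow_prime_ord) auto
  then have "std_subgroup p S = pgl Q <#\<^bsub>PGL\<^esub> std_subgroup p S' #>\<^bsub>PGL\<^esub> inv\<^bsub>PGL\<^esub> pgl Q"
    using Q(1) PGL.conjugate_generate[of "pgl Q" "pgl ?D'"] conj by (simp add: std_subgroup_def)
  then show ?thesis using Q(1) by (metis pgl_in_carrier)
qed

section \<open>General position and admissibility of the diagonal subgroups\<close>

lemma image_line: "(*v) A ` vec.span {w} = vec.span {A *v (w :: complex ^ 'n)}"
  by (simp add: vec.span_singleton image_image matrix_vector_mult_scale)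

lemma proj_point_line:
  assumes "L \<in> proj_points"
  obtains w where "w \<noteq> 0" "L = vec.span {w}"
proof -
  have sub: "vec.subspace L" and dim: "vec.dim L = 1"
    using assms by (auto simp: proj_points_def)
  obtain B where B: "B \<subseteq> L" "vec.independent B" "L \<subseteq> vec.span B" "card B = 1"
    using vec.basis_exists[of L] dim by metis
  then obtain w where "B = {w}" by (auto simp: card_1_singleton_iff)
  then have "L = vec.span {w}" "w \<noteq> 0"
    using B sub vec.span_minimal[of B L] vec.dependent_zero by blast+
  then show ?thesis using that by blast
qed

lemma line_in_proj_points: "w \<noteq> 0 \<Longrightarrow> vec.span {w} \<in> proj_points"
  by (simp add: proj_points_def vec.dim_eq_card_independent)

lemma proj_act_pgl: "L \<in> proj_points \<Longrightarrow> proj_act (pgl A) L = (*v) A ` L"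
  unfolding pgl_def by (rule proj_act_coset) (simp add: proj_points_def)

lemma proj_act_pgl_line: "w \<noteq> 0 \<Longrightarrow> proj_act (pgl A) (vec.span {w}) = vec.span {A *v w}"
  by (simp add: proj_act_pgl line_in_proj_points image_line)

lemma invertible_mult_eq_0_iff:
  fixes A :: "complex ^ 'n ^ 'n"
  assumes "invertible A"
  shows "A *v w = 0 \<longleftrightarrow> w = 0"
  using assms invertible_left_inverse[of A] matrix_left_invertible_ker[of A] by auto

lemma proj_act_mult:
  assumes "g \<in> carrier PGL" "h \<in> carrier PGL" "L \<in> proj_points"
  shows "proj_act (g \<otimes>\<^bsub>PGL\<^esub> h) L = proj_act g (proj_act h L)"
proof -
  obtain A where A: "invertible A" "g = pgl A" using assms(1) by (auto simp: carrier_PGL)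
  obtain B where B: "invertible B" "h = pgl B" using assms(2) by (auto simp: carrier_PGL)
  obtain w where w: "w \<noteq> 0" "L = vec.span {w}" using assms(3) by (rule proj_point_line)
  have "g \<otimes>\<^bsub>PGL\<^esub> h = pgl (A ** B)"
    using A B pgl.hom_mult[of A B] by simp
  then show ?thesis
    using A B w by (simp add: proj_act_pgl_line invertible_mult_eq_0_iff matrix_vector_mul_assoc)
qed

lemma proj_act_one:
  assumes "L \<in> proj_points"
  shows "proj_act \<one>\<^bsub>PGL\<^esub> L = (L :: (complex ^ 'n) set)"
  using proj_act_pgl[OF assms, of "mat 1"] by (simp add: pgl_mat_1)

text \<open>
  General position is stated by dimensions of spans of lines. For chosen spanning vectors
  \<open>r L\<close> it becomes linear independence.
\<close>

lemma general_position_independent: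
  assumes "general_position T" "S \<subseteq> T" "finite S" "card S \<le> CARD('n)"
    and r: "\<And>L. L \<in> T \<Longrightarrow> L = vec.span {r L :: complex ^ 'n}"
  shows "vec.independent (r ` S)" "inj_on r S"
proof -
  show inj: "inj_on r S"
    using r assms(2) by (metis inj_onI subsetD)
  have span: "vec.span (\<Union>S) = vec.span (r ` S)"
  proof (rule vec.span_eq[THEN iffD2], intro conjI)
    show "\<Union>S \<subseteq> vec.span (r ` S)"
    proof
      fix x assume "x \<in> \<Union>S"
      then obtain L where L: "L \<in> S" "x \<in> L" by blast
      then have "x \<in> vec.span {r L}" using r assms(2) by blast
      then show "x \<in> vec.span (r ` S)"
        using vec.span_mono[of "{r L}" "r ` S"] L(1) by blast
    qed
    show "r ` S \<subseteq> vec.span (\<Union>S)"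
    proof
      fix x assume "x \<in> r ` S"
      then obtain L where L: "L \<in> S" "x = r L" by blast
      have "x \<in> vec.span {r L}" unfolding L(2) by (simp add: vec.span_base)
      then have "x \<in> L" using r[of L] L(1) assms(2) by blast
      then show "x \<in> vec.span (\<Union>S)" using L(1) by (blast intro: vec.span_base)
    qed
  qed
  have "vec.dim (vec.span (\<Union>S)) = card S"
    using assms(1-4) unfolding general_position_def by blast
  then have "card (r ` S) = vec.dim (vec.span (r ` S))"
    unfolding span using inj by (simp add: card_image)
  then show "vec.independent (r ` S)"
    using assms(3) by (intro vec.card_le_dim_spanning[of _ "vec.span (r ` S)"]) (auto intro: vec.span_base)
qed

lemma general_position_lines:
  fixes W :: "(complex ^ 'n) set"
  assumes indep: "\<And>U. U \<subseteq> W \<Longrightarrow> finite U \<Longrightarrow> card U \<le> CARD('n) \<Longrightarrow> vec.independent U"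
    and n: "CARD('n) \<ge> 2"
  shows "general_position ((\<lambda>w. vec.span {w}) ` W)" "inj_on (\<lambda>w. vec.span {w}) W"
proof -
  show "inj_on (\<lambda>w. vec.span {w}) W"
  proof (rule inj_onI, rule ccontr)
    fix x y
    assume xy: "x \<in> W" "y \<in> W" "vec.span {x} = vec.span {y}" "x \<noteq> y"
    have "x \<in> vec.span ({x, y} - {x})"
      using xy vec.span_base[of x "{x}"] by (simp add: insert_Diff_if)
    then have "vec.dependent {x, y}"
      unfolding vec.dependent_def by blast
    moreover have "vec.independent {x, y}"
      using xy n by (intro indep) auto
    ultimately show False by blast
  qed
  show "general_position ((\<lambda>w. vec.span {w}) ` W)"
    unfolding general_position_def
  proof (intro conjI allI impI)
    show "(\<lambda>w. vec.span {w}) ` W \<subseteq> proj_points"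
    proof (rule image_subsetI)
      fix w assume "w \<in> W"
      then have "vec.independent {w}" using n by (intro indep) auto
      then show "vec.span {w} \<in> proj_points"
        by (auto intro: line_in_proj_points simp: vec.dependent_single)
    qed
    fix S
    assume S: "S \<subseteq> (\<lambda>w. vec.span {w}) ` W" "finite S \<and> card S \<le> CARD('n)"
    then obtain U where U: "U \<subseteq> W" "inj_on (\<lambda>w. vec.span {w}) U" "S = (\<lambda>w. vec.span {w}) ` U"
      unfolding subset_image_inj by blast
    have "finite U" "card U = card S"
      using U S(2) by (auto dest: finite_imageD simp: card_image)
    then have "vec.independent U" using S(2) U(1) by (intro indep) auto
    moreover have "vec.span (\<Union>S) = vec.span U"
    proof (rule vec.span_eq[THEN iffD2], intro conjI)
      show "\<Union>S \<subseteq> vec.span U"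
        unfolding U(3) using vec.span_mono[of "{_}" U] by blast
      show "U \<subseteq> vec.span (\<Union>S)"
        unfolding U(3) by (blast intro: vec.span_base)
    qed
    ultimately show "vec.dim (vec.span (\<Union>S)) = card S"
      using \<open>card U = card S\<close> by (simp add: vec.dim_eq_card_independent)
  qed
qed

text \<open>
  The vectors \<open>v j\<close> form the orbit of the all-ones vector under the diagonal matrix, and \<open>e\<close> is a
  coordinate vector. A linear relation among some \<open>v j\<close>, read in the coordinate \<open>i\<close>, says that the
  polynomial with the coefficients of the relation has the zero \<open>\<zeta>\<^bsup>a i\<^esup>\<close>, where \<open>a\<close> enumerates
  \<open>S\<close>. If \<open>e\<close> takes part, one coordinate is lost, but then there is also one vector \<open>v j\<close> less. So the
  polynomial has as many zeros as terms, and Chebotarev's theorem applies.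
\<close>

lemma std_subgroup_general_position:
  assumes p: "prime p" "p > CARD('n)" and n: "CARD('n) \<ge> 2"
    and S: "S \<in> exponent_sets p CARD('n)"
  fixes v :: "nat \<Rightarrow> complex ^ 'n" and e :: "complex ^ 'n" and k :: 'n
  defines "v \<equiv> \<lambda>j. \<chi> i. unity p (enumeration S i * int j)" and "e \<equiv> axis k 1"
  shows "inj_on v {..<p}" "e \<notin> range v"
    and "\<And>U. U \<subseteq> insert e (v ` {..<p}) \<Longrightarrow> finite U \<Longrightarrow> card U \<le> CARD('n) \<Longrightarrow> vec.independent U"
proof -
  let ?a = "enumeration S :: 'n \<Rightarrow> int"
  have p0: "p > 0" using p by simp
  have "odd p" using p n prime_odd_nat[of p] by simp
  have inj_a: "inj (\<lambda>i. unity p (?a i))" by (rule inj_std[OF S])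
  have two: "\<exists>i. i \<noteq> j" for j :: 'n
  proof (rule ccontr)
    assume "\<nexists>i. i \<noteq> j"
    then have "CARD('n) \<le> card {j}" by (intro card_mono) auto
    then show False using n by simp
  qed
  show inj_v: "inj_on v {..<p}"
  proof (rule inj_onI)
    fix x y
    assume xy: "x \<in> {..<p}" "y \<in> {..<p}" "v x = v y"
    obtain i j :: 'n where "i \<noteq> j" using two by blast
    then have "unity p (?a i) \<noteq> unity p (?a j)" using inj_a by (meson injD)
    then have "\<exists>i. unity p (?a i) \<noteq> 1" by metis
    then obtain l where l: "\<not> int p dvd ?a l" using p0 by (auto simp: unity_eq_1_iff)
    have "unity p (?a l * int x) = unity p (?a l * int y)"
      using arg_cong[OF xy(3), of "\<lambda>w. w $ l"] by (simp add: v_def)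
    then have "int p dvd ?a l * (int x - int y)"
      using p0 by (simp add: unity_eq_iff mod_eq_dvd_iff right_diff_distrib)
    then have "int p dvd int x - int y"
      using l p(1) by (simp add: prime_dvd_mult_iff)
    then have "int x mod int p = int y mod int p" by (simp add: mod_eq_dvd_iff)
    then show "x = y" using xy(1,2) by simp
  qed
  show e_v: "e \<notin> range v"
  proof
    assume "e \<in> range v"
    then obtain j where j: "e = v j" by blast
    obtain i where "i \<noteq> k" using two by blast
    then have "e $ i = 0" by (simp add: e_def axis_def)
    then show False unfolding j by (simp add: v_def)
  qed
  fix U
  assume U: "U \<subseteq> insert e (v ` {..<p})" "finite U" "card U \<le> CARD('n)"
  show "vec.independent U"
    unfolding vec.dependent_finite[OF U(2)] not_ex
  proof (intro allI notI)
    fix u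
    assume u: "(\<exists>w\<in>U. u w \<noteq> 0) \<and> (\<Sum>w\<in>U. u w *s w) = 0"
    define X where "X = {j\<in>{..<p}. v j \<in> U}"
    have fin: "finite X" by (simp add: X_def)
    have vX: "v ` X = U - {e}"
      using U(1) e_v by (auto simp: X_def)
    have cardX: "card X = card (U - {e})"
      unfolding vX[symmetric]
      by (rule card_image[symmetric]) (auto intro: inj_on_subset[OF inj_v] simp: X_def)
    define g where "g = (\<Sum>j\<in>X. Polynomial.monom (u (v j)) j)"
    have coeff_g: "coeff g j = (if j \<in> X then u (v j) else 0)" for j
      using fin by (simp add: g_def coeff_sum)
    \<comment> \<open>the coordinates in which \<open>e\<close> does not contribute to the relation\<close>
    define I where "I = {i. i \<noteq> k \<or> e \<notin> U}"
    define Z where "Z = (\<lambda>i. unity p (?a i)) ` I"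
    have zeros: "poly g z = 0" if "z \<in> Z" for z
    proof -
      obtain i where i: "i \<in> I" "z = unity p (?a i)" using \<open>z \<in> Z\<close> by (auto simp: Z_def)
      have "poly g z = (\<Sum>j\<in>X. u (v j) * unity p (?a i * int j))"
        by (simp add: g_def poly_sum poly_monom i(2) unity_power)
      also have "\<dots> = (\<Sum>j\<in>X. (u (v j) *s v j) $ i)"
        by (simp add: v_def)
      also have "\<dots> = (\<Sum>w\<in>v ` X. (u w *s w) $ i)"
        by (rule sum.reindex_cong[symmetric, of v])
           (auto intro: inj_on_subset[OF inj_v] simp: X_def)
      also have "\<dots> = (\<Sum>w\<in>U. (u w *s w) $ i)"
        unfolding vX using U(2) i(1)
        by (intro sum.mono_neutral_left) (auto simp: I_def e_def axis_def)
      also have "\<dots> = (\<Sum>w\<in>U. u w *s w) $ i"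
        by (simp add: sum_component)
      finally show ?thesis using u by simp
    qed
    have "card Z = card I"
      unfolding Z_def by (rule card_image) (rule inj_on_subset[OF inj_a], simp)
    moreover have "card X \<le> card I"
    proof (cases "e \<in> U")
      case True
      then have "I = UNIV - {k}" by (auto simp: I_def)
      then show ?thesis using True U(2,3) by (simp add: cardX card_Diff_singleton)
    next
      case False
      then have "I = UNIV" by (auto simp: I_def)
      then show ?thesis using False U(3) by (simp add: cardX)
    qed
    moreover have "card {j. coeff g j \<noteq> 0} \<le> card X"
      using fin by (intro card_mono) (auto simp: coeff_g)
    ultimately have few: "card {j. coeff g j \<noteq> 0} \<le> card Z" by linarith
    have "g = 0"
    proof (rule ccontr)
      assume "g \<noteq> 0"
      have "degree g \<le> p - 1"
        by (rule degree_le) (auto simp: coeff_g X_def)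
      then have "degree g < p" using p0 by linarith
      moreover have "Z \<subseteq> {z. z ^ p = 1}"
        using p0 by (auto simp: Z_def unity_power_order)
      ultimately have "card Z < card {j. coeff g j \<noteq> 0}"
        using chebotarev_uncertainty[OF p(1) \<open>odd p\<close>] \<open>g \<noteq> 0\<close> zeros by blast
      then show False using few by simp
    qed
    then have "u (v j) = 0" if "j \<in> X" for j
      using coeff_g[of j] that by simp
    then have zero: "u w = 0" if "w \<in> U" "w \<noteq> e" for w
      using vX that by (metis DiffI imageE singletonD)
    then obtain w where "w \<in> U" "u w \<noteq> 0" "w = e" using u by blast
    moreover from this have "(\<Sum>w\<in>U. u w *s w) = u e *s e"
      using zero U(2) by (simp add: sum.remove[of U e])
    ultimately show False
      using u by (simp add: e_def axis_eq_0_iff)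
  qed
qed

text \<open>
  The orbit of the all-ones point has \<open>p\<close> elements, which for \<open>p = n + 1\<close> is one less than the required
  \<open>n + 2\<close>. A coordinate point, which is fixed by all diagonal matrices, supplies the missing point.
\<close>

theorem admissible_std_subgroup:
  assumes p: "prime p" "p > CARD('n)" and n: "CARD('n) \<ge> 2"
    and S: "S \<in> exponent_sets p CARD('n)"
  shows "admissible (std_subgroup p S :: (complex ^ 'n ^ 'n) set set)"
proof -
  let ?D = "std_matrix p S :: complex ^ 'n ^ 'n"
  have p0: "p > 0" using p by simp
  define v :: "nat \<Rightarrow> complex ^ 'n" where "v = (\<lambda>j. \<chi> i. unity p (enumeration S i * int j))"
  fix k :: 'n
  define e :: "complex ^ 'n" where "e = axis k 1"
  define W where "W = insert e (v ` {..<p})"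
  define T where "T = (\<lambda>w. vec.span {w}) ` W"
  note gp = std_subgroup_general_position[OF p n S, folded v_def]
  have T: "general_position T" "inj_on (\<lambda>w. vec.span {w}) W"
    unfolding T_def using general_position_lines[of W] gp(3)[of _ k] n unfolding W_def e_def by blast+
  have "e \<notin> v ` {..<p}" using gp(2)[of k] by (auto simp: e_def)
  then have "card T = Suc p"
    using T(2) gp(1) by (simp add: T_def W_def card_image)
  have "finite T" by (simp add: T_def W_def)
  have TP: "T \<subseteq> proj_points" using T(1) by (simp add: general_position_def)
  have W0: "w \<noteq> 0" if "w \<in> W" for w
  proof -
    have "vec.span {w} \<in> proj_points" using TP that by (auto simp: T_def)
    then show ?thesis by (auto simp: proj_points_def)
  qed
  have gen: "proj_act (pgl ?D) L \<in> T" if "L \<in> T" for L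
  proof -
    obtain w where w: "w \<in> W" "L = vec.span {w}" using \<open>L \<in> T\<close> by (auto simp: T_def)
    have act: "proj_act (pgl ?D) L = vec.span {?D *v w}"
      using W0[OF w(1)] by (simp add: w(2) proj_act_pgl_line)
    consider "w = e" | j where "j < p" "w = v j" using w(1) by (auto simp: W_def)
    then show ?thesis
    proof cases
      case 1
      have De: "?D *v e = unity p (enumeration S k) *s e"
        by (auto simp: vec_eq_iff e_def axis_def std_matrix_def)
      have "vec.span {?D *v e} = vec.span {e}"
      proof (rule vec.span_eq[THEN iffD2], intro conjI)
        show "{?D *v e} \<subseteq> vec.span {e}"
          unfolding De by (simp add: vec.span_base vec.span_scale)
        have "e = inverse (unity p (enumeration S k)) *s (?D *v e)"
          unfolding De by simp
        then show "{e} \<subseteq> vec.span {?D *v e}"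
          by (metis empty_subsetI insert_subset singletonI vec.span_base vec.span_scale)
      qed
      then show ?thesis unfolding act 1 by (simp add: T_def W_def)
    next
      case 2
      have "(?D *v v j) $ i = v (Suc j mod p) $ i" for i
      proof -
        have "(?D *v v j) $ i = unity p (enumeration S i * int (Suc j))"
          by (simp add: std_matrix_def v_def distrib_left flip: unity_add)
        also have "\<dots> = unity p (enumeration S i * int (Suc j mod p))"
          using p0 by (simp add: unity_eq_iff zmod_int mod_simps del: of_nat_Suc)
        finally show ?thesis by (simp add: v_def)
      qed
      then have "?D *v v j = v (Suc j mod p)" by (simp add: vec_eq_iff)
      then show ?thesis unfolding act 2(2) using p0 by (simp add: T_def W_def)
    qed
  qed
  have sub: "std_subgroup p S \<subseteq> carrier (PGL :: (complex ^ 'n ^ 'n) set monoid)"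
    using subgroup_std by (rule subgroup.subset)
  have "proj_act (pgl ?D [^]\<^bsub>PGL\<^esub> m) L \<in> T" if "L \<in> T" for m :: nat and L
    using that
  proof (induction m arbitrary: L)
    case 0
    then show ?case using TP by (auto simp: proj_act_one)
  next
    case (Suc m)
    have "proj_act (pgl ?D [^]\<^bsub>PGL\<^esub> Suc m) L = proj_act (pgl ?D [^]\<^bsub>PGL\<^esub> m) (proj_act (pgl ?D) L)"
      using Suc.prems TP by (simp add: proj_act_mult subset_iff)
    then show ?case using Suc gen by simp
  qed
  moreover have "PGL.ord (pgl ?D) \<noteq> 0" using ord_std[OF p(1) S n] p0 by simp
  ultimately have closed: "proj_act h L \<in> T" if "h \<in> std_subgroup p S" "L \<in> T" for h L
    using that PGL.generate_pow_nat[of "pgl ?D"] by (auto simp: std_subgroup_def)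
  have "std_subgroup p S \<subseteq> proj_Aut T"
  proof
    fix h :: "(complex ^ 'n ^ 'n) set"
    assume h: "h \<in> std_subgroup p S"
    then have h': "inv\<^bsub>PGL\<^esub> h \<in> std_subgroup p S"
      by (rule subgroup.m_inv_closed[OF subgroup_std])
    have "L \<in> proj_act h ` T" if "L \<in> T" for L
    proof -
      have "proj_act h (proj_act (inv\<^bsub>PGL\<^esub> h) L) = proj_act (h \<otimes>\<^bsub>PGL\<^esub> inv\<^bsub>PGL\<^esub> h) L"
        using that TP h h' sub by (intro proj_act_mult[symmetric]) auto
      also have "h \<otimes>\<^bsub>PGL\<^esub> inv\<^bsub>PGL\<^esub> h = \<one>\<^bsub>PGL\<^esub>"
        using h sub by (intro PGL.r_inv) blast
      also have "proj_act \<one>\<^bsub>PGL\<^esub> L = L"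
        using that TP by (intro proj_act_one) blast
      finally show ?thesis using closed[OF h' that] by (metis imageI)
    qed
    then have "proj_act h ` T = T" using closed[OF h] by blast
    then show "h \<in> proj_Aut T" using h sub by (auto simp: proj_Aut_def)
  qed
  moreover have "finite (std_subgroup p S :: (complex ^ 'n ^ 'n) set set)"
    using card_std_subgroup[OF p(1) S n] p0 card_gt_0_iff by metis
  ultimately show ?thesis
    unfolding admissible_def using subgroup_std T(1) \<open>finite T\<close> \<open>card T = Suc p\<close> p(2)
    by (intro conjI exI[of _ T]) auto
qed

section \<open>Admissible subgroups of prime order are diagonalizable\<close>

text \<open>
  Take \<open>n\<close> of the points as a basis \<open>V\<close> of eigenvectors and write the vector \<open>x\<close> of one more point in it.
  General position makes all coefficients nonzero, so that comparing \<open>A x\<close> with \<open>m x *s x\<close> forces all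
  eigenvalues to be equal.
\<close>

lemma scalar_if_fixes_frame:
  fixes A :: "complex ^ 'n ^ 'n"
  assumes gp: "general_position T" and T: "finite T" "CARD('n) < card T"
    and fixed: "\<And>L. L \<in> T \<Longrightarrow> (*v) A ` L = L"
  shows "\<exists>c. A = mat c"
proof -
  have "\<forall>L\<in>T. \<exists>w. L = vec.span {w}"
    using gp proj_point_line unfolding general_position_def by (metis subsetD)
  then obtain r where r: "\<And>L. L \<in> T \<Longrightarrow> L = vec.span {r L}" by metis
  have "\<exists>c. A *v w = c *s w" if "w \<in> r ` T" for w
  proof -
    obtain L where L: "L \<in> T" "w = r L" using \<open>w \<in> r ` T\<close> by blast
    have "w \<in> L" using r[OF L(1)] L(2) vec.span_base[of w "{w}"] by simp
    then have "A *v w \<in> L" using fixed[OF L(1)] by blast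
    then show ?thesis using r[OF L(1)] L(2) by (auto simp: vec.span_singleton)
  qed
  \<comment> \<open>\<open>m w\<close> is the eigenvalue of the spanning vector \<open>w\<close> of a fixed point\<close>
  then obtain m where m: "\<And>w. w \<in> r ` T \<Longrightarrow> A *v w = m w *s w" by metis
  obtain B where B: "B \<subseteq> T" "card B = CARD('n)" "finite B"
    using obtain_subset_with_card_n[of "CARD('n)" T] T(2) by auto
  have "B \<noteq> T" using B(2) T(2) by auto
  then obtain L0 where L0: "L0 \<in> T" "L0 \<notin> B" using B(1) by blast
  define V where "V = r ` B"
  define x where "x = r L0"
  have V: "vec.independent V" "inj_on r B" "finite V" "V \<subseteq> r ` T"
    unfolding V_def using general_position_independent[OF gp B(1,3) _ r] B by auto
  have full: "y \<in> vec.span V" for y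
  proof -
    have "vec.dim (UNIV :: (complex ^ 'n) set) \<le> card V"
      unfolding vec_dim_card using V(2) B(2) by (simp add: V_def card_image)
    then have "(UNIV :: (complex ^ 'n) set) \<subseteq> vec.span V"
      using V(1) by (intro vec.card_ge_dim_independent) auto
    then show ?thesis by blast
  qed
  then obtain u where u: "x = (\<Sum>w\<in>V. u w *s w)"
    using vec.span_finite[OF V(3)] by blast
  have "(\<Sum>w\<in>V. (u w * (m w - m x)) *s w) = A *v x - m x *s x"
  proof -
    have "A *v x = (\<Sum>w\<in>V. A *v (u w *s w))"
      unfolding u by (rule vec.linear_sum[OF matrix_vector_mul_linear_gen])
    also have "\<dots> = (\<Sum>w\<in>V. (u w * m w) *s w)"
      using V(4) by (intro sum.cong) (auto simp: matrix_vector_mult_scale m)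
    finally have "A *v x = (\<Sum>w\<in>V. (u w * m w) *s w)" .
    moreover have "m x *s x = (\<Sum>w\<in>V. (u w * m x) *s w)"
      using arg_cong[OF u, of "\<lambda>y. m x *s y"] by (simp add: vec.scale_sum_right mult.commute)
    ultimately show ?thesis
      by (simp add: right_diff_distrib vec.scale_left_diff_distrib sum_subtractf)
  qed
  also have "\<dots> = 0" using m[of x] L0(1) by (simp add: x_def)
  finally have sum0: "(\<Sum>w\<in>V. (u w * (m w - m x)) *s w) = 0" .
  have "u w * (m w - m x) = 0" if "w \<in> V" for w
    by (rule vec.independentD[OF V(1,3) subset_refl sum0 that])
  moreover have "u w \<noteq> 0" if "w \<in> V" for w
  proof
    assume "u w = 0"
    then have "x = (\<Sum>w\<in>V - {w}. u w *s w)"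
      using u \<open>w \<in> V\<close> V(3) by (simp add: sum.remove)
    then have x_span: "x \<in> vec.span (V - {w})"
      by (metis (no_types, lifting) vec.span_sum vec.span_base vec.span_scale)
    obtain b where b: "b \<in> B" "w = r b" using \<open>w \<in> V\<close> by (auto simp: V_def)
    have Vw: "V - {w} = r ` (B - {b})"
      using V(2) b by (auto simp: V_def inj_on_def)
    let ?S = "insert L0 (B - {b})"
    have "card ?S = CARD('n)"
      using B L0 b by (simp add: card_Suc_Diff1)
    then have "vec.independent (r ` ?S)" "inj_on r ?S"
      using general_position_independent[OF gp _ _ _ r, of ?S] B L0 by auto
    moreover from this have "r ` ?S - {x} = V - {w}"
      unfolding Vw using L0 by (auto simp: x_def)
    then have "x \<in> vec.span (r ` ?S - {x})" using x_span by simp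
    moreover have "x \<in> r ` ?S" by (simp add: x_def)
    ultimately show False
      unfolding vec.dependent_def by (meson bexI)
  qed
  ultimately have m_eq: "A *v w = m x *s w" if "w \<in> V" for w
    using m[of w] V(4) that by auto
  have "A *v y = m x *s y" for y
    using full[of y]
  proof (induction rule: vec.span_induct_alt)
    case (step c w y)
    then show ?case
      by (simp add: matrix_vector_right_distrib matrix_vector_mult_scale m_eq vec.scale_right_distrib mult.commute)
  qed simp
  then have "A = mat (m x)" by (simp add: matrix_eq mat_vector_mult)
  then show ?thesis by blast
qed

text \<open>
  Some multiple of \<open>d\<close> is congruent to 1 modulo \<open>p\<close>.
\<close>

lemma funpow_coprime_fixed:
  fixes F :: "'a \<Rightarrow> 'a"
  assumes "prime p" "(F ^^ p) x = x" "(F ^^ d) x = x" "0 < d" "d < p"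
  shows "F x = x"
proof -
  have mult: "(F ^^ (k * q)) x = x" if "(F ^^ k) x = x" for k q
    using that by (induction q) (simp_all add: funpow_add)
  have "coprime d p"
    using assms by (metis coprime_commute nat_dvd_not_less prime_imp_coprime)
  then obtain a where "[d * a = Suc 0] (mod p)"
    using cong_solve_coprime_nat by blast
  then have "d * a mod p = 1"
    using prime_gt_1_nat[OF assms(1)] by (simp add: cong_def)
  then obtain q where q: "d * a = Suc (p * q)"
    by (metis mod_mult_div_eq plus_1_eq_Suc)
  have "(F ^^ (d * a)) x = F ((F ^^ (p * q)) x)"
    unfolding q by simp
  then show ?thesis using mult[OF assms(2)] mult[OF assms(3)] by simp
qed

lemma sum_unity:
  assumes "p > 0" "i < p"
  shows "(\<Sum>j<p. unity p (- (int j * int i))) = (if i = 0 then of_nat p else 0)"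
proof -
  have eq: "unity p (- (int j * int i)) = unity p (- int i) ^ j" for j
    by (simp add: unity_power mult.commute)
  show ?thesis
  proof (cases "i = 0")
    case False
    then have "unity p (- int i) \<noteq> 1"
      using assms by (auto simp: unity_eq_1_iff dest: zdvd_imp_le)
    then have "(\<Sum>j<p. unity p (- int i) ^ j) = 0"
      using assms(1) by (simp add: geometric_sum unity_power_order)
    then show ?thesis using False by (simp only: eq if_False)
  qed simp
qed

text \<open>
  Let \<open>v\<close> span a point that \<open>A\<close> moves. The discrete Fourier transform
  \<open>w j = (\<Sum>i<p. \<zeta>\<^bsup>- i j\<^esup> A\<^sup>i v)\<close> decomposes \<open>p v\<close> into eigenvectors for the eigenvalues \<open>\<zeta>\<^sup>j\<close>, and their
  span contains all \<open>A\<^sup>i v\<close>. As \<open>p\<close> is prime the points of these vectors are distinct for \<open>i < n\<close>, and by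
  general position they span the whole space. So at least \<open>n\<close> of the \<open>w j\<close> are nonzero.
\<close>

lemma distinct_eigenvalues_if_preserves:
  fixes A :: "complex ^ 'n ^ 'n"
  assumes p: "prime p" "CARD('n) < p" and A: "invertible A" "A [^]\<^bsub>GL\<^esub> p = mat 1"
    and not_scalar: "\<And>c. A \<noteq> mat c"
    and gp: "general_position T" and T: "finite T" "CARD('n) < card T"
    and invar: "proj_act (pgl A) ` T = T"
  shows "\<exists>S\<in>exponent_sets p CARD('n). unity p ` S \<subseteq> spectrum A"
proof -
  have p0: "p > 0" using p by simp
  have TP: "T \<subseteq> proj_points" using gp by (simp add: general_position_def)
  obtain L where L: "L \<in> T" "(*v) A ` L \<noteq> L"
    using scalar_if_fixes_frame[OF gp T, of A] not_scalar by blast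
  obtain v where v: "v \<noteq> 0" "L = vec.span {v}"
    using L(1) TP proj_point_line by blast
  define x where "x i = ((*v) A ^^ i) v" for i
  have x_Suc: "A *v x i = x (Suc i)" for i by (simp add: x_def)
  have x0: "x 0 = v" by (simp add: x_def)
  have xp: "x p = v"
    unfolding x_def using A(2) by (metis GL_pow_mult_vector matrix_vector_mul_lid)
  have xnz: "x i \<noteq> 0" for i
    by (induction i) (simp_all add: x0 v(1) invertible_mult_eq_0_iff A(1) flip: x_Suc)
  let ?F = "proj_act (pgl A)"
  have F: "(?F ^^ i) L = vec.span {x i}" for i
    by (induction i) (simp_all add: x0 v(2) xnz proj_act_pgl_line x_Suc)
  have in_T: "vec.span {x i} \<in> T" for i
    unfolding F[symmetric] using L(1) invar by (induction i) auto
  have inj: "vec.span {x i} \<noteq> vec.span {x j}" if "i < j" "j < p" for i j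
  proof
    assume "vec.span {x i} = vec.span {x j}"
    \<comment> \<open>moving on by \<open>p - i\<close> steps shows that \<open>j - i\<close> steps lead from \<open>L\<close> back to \<open>L\<close>\<close>
    then have "(?F ^^ (p - i)) ((?F ^^ i) L) = (?F ^^ (p - i)) ((?F ^^ j) L)"
      by (simp add: F)
    moreover have "(?F ^^ (p - i)) ((?F ^^ j) L) = (?F ^^ (j - i)) ((?F ^^ p) L)"
    proof -
      have "p - i + j = j - i + p" using that by simp
      then show ?thesis by (metis funpow_add o_apply)
    qed
    moreover have "(?F ^^ (p - i)) ((?F ^^ i) L) = (?F ^^ p) L"
      using that by (metis funpow_add o_apply le_add_diff_inverse2 less_imp_le_nat less_trans)
    moreover have Fp: "(?F ^^ p) L = L" by (simp only: F xp v(2)[symmetric])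
    ultimately have Fd: "(?F ^^ (j - i)) L = L" by simp
    have "?F L = L"
      using that by (intro funpow_coprime_fixed[OF p(1) Fp Fd]) auto
    then show False using L TP proj_act_pgl[of L A] by auto
  qed
  define w where "w j = (\<Sum>i<p. unity p (- (int j * int i)) *s x i)" for j :: nat
  have eig: "A *v w j = unity p (int j) *s w j" for j
  proof -
    \<comment> \<open>\<open>h\<close> has period \<open>p\<close>, so the sum may be shifted by the step that \<open>A\<close> makes\<close>
    define h where "h i = unity p (- (int j * int i)) *s x i" for i
    have "unity p (- (int j * int i)) = unity p (int j) * unity p (- (int j * int (Suc i)))" for i
      unfolding unity_add[symmetric] by (simp add: algebra_simps)
    then have "A *v h i = unity p (int j) *s h (Suc i)" for i
      by (simp add: h_def matrix_vector_mult_scale x_Suc)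
    moreover have "A *v w j = (\<Sum>i<p. A *v h i)"
      unfolding w_def h_def by (rule vec.linear_sum[OF matrix_vector_mul_linear_gen])
    ultimately have "A *v w j = unity p (int j) *s (\<Sum>i<p. h (Suc i))"
      by (simp add: vec.scale_sum_right)
    moreover have "h p = h 0"
      using p0 unity_eq_1_iff[of p "- (int j * int p)"] by (simp add: h_def x0 xp)
    then have "(\<Sum>i<p. h (Suc i)) = (\<Sum>i<p. h i)"
      using sum.lessThan_Suc_shift[of h p] by simp
    ultimately show ?thesis by (simp add: w_def h_def)
  qed
  define J where "J = {j\<in>{..<p}. w j \<noteq> 0}"
  have "finite J" by (simp add: J_def)
  have sum_w: "(\<Sum>j<p. w j) = of_nat p *s v"
  proof -
    have "(\<Sum>j<p. w j) = (\<Sum>i<p. (\<Sum>j<p. unity p (- (int j * int i))) *s x i)"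
      unfolding w_def by (subst sum.swap) (simp add: vec.scale_sum_left)
    also have "\<dots> = (\<Sum>i<p. (if i = 0 then of_nat p *s x i else 0))"
      using p0 by (intro sum.cong) (simp_all add: sum_unity)
    also have "\<dots> = of_nat p *s v" using p0 by (simp add: x0)
    finally show ?thesis .
  qed
  have "x k \<in> vec.span (w ` J)" for k
  proof (induction k)
    case 0
    have "w j \<in> vec.span (w ` J)" if "j < p" for j
      using that by (cases "w j = 0") (auto simp: J_def vec.span_zero intro: vec.span_base)
    then have "(\<Sum>j<p. w j) \<in> vec.span (w ` J)" by (intro vec.span_sum) auto
    then have "inverse (of_nat p) *s (of_nat p *s v) \<in> vec.span (w ` J)"
      unfolding sum_w by (rule vec.span_scale)
    then show ?case using p0 by (simp add: x0)
  next
    case (Suc k)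
    then have "A *v x k \<in> vec.span (w ` J)"
    proof (induction rule: vec.span_induct_alt)
      case (step c y z)
      then obtain j where j: "j \<in> J" "y = w j" by blast
      then have "w j \<in> vec.span (w ` J)" by (intro vec.span_base imageI)
      then have "A *v y \<in> vec.span (w ` J)" unfolding j(2) eig by (rule vec.span_scale)
      then show ?case
        using step by (simp add: matrix_vector_right_distrib matrix_vector_mult_scale vec.span_add vec.span_scale)
    qed (simp add: vec.span_zero)
    then show ?case by (simp add: x_Suc)
  qed
  then have sub: "vec.span {x i} \<subseteq> vec.span (w ` J)" for i
    by (intro vec.span_minimal) auto
  let ?O = "(\<lambda>i. vec.span {x i}) ` {..<CARD('n)}"
  have "inj_on (\<lambda>i. vec.span {x i}) {..<CARD('n)}"
    using inj p(2) by (intro linorder_inj_onI) auto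
  then have "card ?O = CARD('n)" by (simp add: card_image)
  then have "vec.dim (vec.span (\<Union>?O)) = CARD('n)"
    using gp in_T unfolding general_position_def by (metis (no_types, lifting) finite_imageI finite_lessThan image_subsetI order_refl)
  moreover have "vec.dim (vec.span (\<Union>?O)) \<le> card (w ` J)"
    using sub \<open>finite J\<close> by (intro vec.dim_le_card vec.span_minimal) (auto simp: vec.subspace_span)
  moreover have "card (w ` J) \<le> card J" using \<open>finite J\<close> by (rule card_image_le)
  ultimately have "CARD('n) \<le> card J" by simp
  then obtain S where S: "S \<subseteq> J" "card S = CARD('n)" by (rule obtain_subset_with_card_n)
  have "int ` S \<in> exponent_sets p CARD('n)"
    using S by (auto simp: exponent_sets_def card_image J_def)
  moreover have "unity p ` int ` S \<subseteq> spectrum A"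
    using S(1) eig unfolding spectrum_def J_def by blast
  ultimately show ?thesis by blast
qed

text \<open>
  The generator, scaled to have order \<open>p\<close> as a matrix, has \<open>n\<close> distinct eigenvalues \<open>\<zeta>\<^sup>s\<close> and is
  therefore similar to the diagonal matrix of the set \<open>S\<close> of these exponents.
\<close>

theorem conjugate_to_std_subgroup:
  fixes H :: "(complex ^ 'n ^ 'n) set set"
  assumes p: "prime p" "CARD('n) < p"
    and H: "admissible H" "cyclic_group (PGL\<lparr>carrier := H\<rparr>)" "card H = p"
  shows "\<exists>S\<in>exponent_sets p CARD('n). \<exists>g\<in>carrier PGL.
    H = g <#\<^bsub>PGL\<^esub> std_subgroup p S #>\<^bsub>PGL\<^esub> inv\<^bsub>PGL\<^esub> g"
proof -
  have p0: "p > 0" using p by simp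
  have sub: "subgroup H PGL" using H(1) by (simp add: admissible_def)
  obtain T where T: "finite T" "CARD('n) + 2 \<le> card T" "general_position T" "H \<subseteq> proj_Aut T"
    using H(1) by (auto simp: admissible_def)
  obtain f where f: "f \<in> H" "subgroup_generated (PGL\<lparr>carrier := H\<rparr>) {f} = PGL\<lparr>carrier := H\<rparr>"
    using H(2) by (auto simp: cyclic_group_def)
  have fc: "f \<in> carrier PGL" using f(1) sub by (meson subgroup.mem_carrier)
  have "H = generate (PGL\<lparr>carrier := H\<rparr>) {f}"
    using arg_cong[OF f(2), of carrier] f(1) by (simp add: carrier_subgroup_generated)
  then have Hgen: "H = generate PGL {f}"
    using f(1) sub by (simp add: PGL.generate_consistent)
  then have ord: "PGL.ord f = p"
    using PGL.generate_pow_card[OF fc] H(3) by simp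
  obtain A0 where A0: "invertible A0" "f = pgl A0" using fc by (auto simp: carrier_PGL)
  have "f [^]\<^bsub>PGL\<^esub> p = \<one>\<^bsub>PGL\<^esub>"
    using PGL.pow_ord_eq_1[OF fc] unfolding ord .
  then have "pgl (A0 [^]\<^bsub>GL\<^esub> p) = \<one>\<^bsub>PGL\<^esub>"
    using A0 by (simp add: pgl.hom_nat_pow)
  then obtain c where c: "c \<noteq> 0" "A0 [^]\<^bsub>GL\<^esub> p = mat c" by (auto simp: pgl_eq_one_iff)
  \<comment> \<open>rescaling by a \<open>p\<close>-th root of \<open>1 / c\<close> turns \<open>A0\<^sup>p = c\<close> into \<open>A\<^sup>p = 1\<close>\<close>
  obtain d where d: "inverse c = d ^ p"
    using exists_complex_root[of p "inverse c"] p0 by auto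
  have d0: "d \<noteq> 0" using d c(1) p0 by (auto simp: power_0_left)
  define A where "A = mat d ** A0"
  have "(mat d ** A0) [^]\<^bsub>GL\<^esub> k = mat (d ^ k) ** (A0 [^]\<^bsub>GL\<^esub> k)" for k :: nat
  proof (induction k)
    case (Suc k)
    have "(mat d ** A0) [^]\<^bsub>GL\<^esub> Suc k = mat (d ^ k) ** (A0 [^]\<^bsub>GL\<^esub> k ** mat d) ** A0"
      using Suc by (simp add: matrix_mul_assoc)
    also have "\<dots> = (mat (d ^ k) ** mat d) ** (A0 [^]\<^bsub>GL\<^esub> k) ** A0"
      unfolding mat_times_commute[of d "A0 [^]\<^bsub>GL\<^esub> k", symmetric] matrix_mul_assoc ..
    finally show ?case by (simp add: mat_times_mat matrix_mul_assoc mult.commute)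
  qed simp
  then have Ap: "A [^]\<^bsub>GL\<^esub> p = mat 1"
    using c d by (simp add: A_def mat_times_mat flip: d)
  have "invertible (mat d :: complex ^ 'n ^ 'n)"
    using d0 by (simp add: mat_eq_diag invertible_diag)
  then have invA: "invertible A" using A0(1) by (simp add: A_def invertible_mult)
  have fA: "f = pgl A"
    unfolding A0(2) pgl_eq_iff
    using d0 by (intro exI[of _ "inverse d"]) (simp add: A_def matrix_mul_assoc mat_times_mat)
  have "A \<noteq> mat c" for c
  proof
    assume "A = mat c"
    moreover have "c \<noteq> 0"
    proof
      assume "c = 0"
      then have "A *v axis undefined 1 = 0" using \<open>A = mat c\<close> by (simp add: mat_vector_mult)
      then show False using invA by (simp add: invertible_mult_eq_0_iff axis_eq_0_iff)
    qed
    ultimately have "f = \<one>\<^bsub>PGL\<^esub>" by (auto simp: fA pgl_eq_one_iff)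
    then show False using ord prime_gt_1_nat[OF p(1)] by simp
  qed
  moreover have "proj_act (pgl A) ` T = T"
    using f(1) T(4) by (auto simp: fA proj_Aut_def)
  ultimately obtain S where S: "S \<in> exponent_sets p CARD('n)" "unity p ` S \<subseteq> spectrum A"
    using distinct_eigenvalues_if_preserves[OF p invA Ap _ T(3,1)] T(2) by auto
  let ?D = "std_matrix p S :: complex ^ 'n ^ 'n"
  have "range (\<lambda>i::'n. unity p (enumeration S i)) \<subseteq> spectrum A"
    using S by (simp add: range_enum)
  then obtain Q where Q: "invertible Q" "A ** Q = Q ** ?D"
    using diagonalizable_if_distinct_eigenvalues[OF inj_std[OF S(1)]]
    unfolding std_matrix_def by blast
  have "f \<otimes>\<^bsub>PGL\<^esub> pgl Q = pgl Q \<otimes>\<^bsub>PGL\<^esub> pgl ?D"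
    using Q invA pgl.hom_mult[of A Q] pgl.hom_mult[of Q ?D] by (simp add: fA)
  then have "f = pgl Q \<otimes>\<^bsub>PGL\<^esub> pgl ?D \<otimes>\<^bsub>PGL\<^esub> inv\<^bsub>PGL\<^esub> pgl Q"
    using Q(1) fc by (subst PGL.inv_solve_right) auto
  then have "H = pgl Q <#\<^bsub>PGL\<^esub> std_subgroup p S #>\<^bsub>PGL\<^esub> inv\<^bsub>PGL\<^esub> pgl Q"
    using Q(1) PGL.conjugate_generate[of "pgl Q" "pgl ?D"] by (simp add: Hgen std_subgroup_def)
  then show ?thesis using S(1) Q(1) by (intro bexI[of _ S] bexI[of _ "pgl Q"]) auto
qed

section \<open>Classes of subgroups as orbits of the affine group\<close>

lemma card_image_eq_if_same_kernel:
  assumes "\<And>x y. x \<in> E \<Longrightarrow> y \<in> E \<Longrightarrow> f x = f y \<longleftrightarrow> h x = h y"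
  shows "card (f ` E) = card (h ` E)"
proof -
  let ?k = "\<lambda>z. h (inv_into E f z)"
  have k: "?k (f x) = h x" if "x \<in> E" for x
    using that assms[of "inv_into E f (f x)" x] by (simp add: inv_into_into f_inv_into_f)
  have "inj_on ?k (f ` E)"
    by (rule inj_onI) (auto simp: k assms)
  moreover have "?k ` (f ` E) = h ` E"
    unfolding image_image by (rule image_cong) (simp_all add: k)
  ultimately show ?thesis by (metis card_image)
qed

text \<open>
  The pair \<open>(m, b)\<close> stands for \<open>x \<mapsto> m x + b\<close> modulo \<open>p\<close>, and the product is composition.
\<close>

definition affine_group :: "nat \<Rightarrow> (int \<times> int) monoid" where
  "affine_group p = \<lparr>carrier = {1..<int p} \<times> {0..<int p},
     mult = (\<lambda>(m, b) (m', b'). (m * m' mod int p, (m * b' + b) mod int p)), one = (1, 0)\<rparr>"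

definition affine_action :: "nat \<Rightarrow> nat \<Rightarrow> int \<times> int \<Rightarrow> int set \<Rightarrow> int set" where
  "affine_action p n = (\<lambda>(m, b). \<lambda>S\<in>exponent_sets p n. affine_mod p m b ` S)"

lemma not_dvd_unit: "m \<in> {1..<int p} \<Longrightarrow> \<not> int p dvd m"
  by (auto dest: zdvd_imp_le)

lemma mult_mod_in_units:
  assumes "prime p" "m \<in> {1..<int p}" "k \<in> {1..<int p}"
  shows "m * k mod int p \<in> {1..<int p}"
proof -
  have "m * k mod int p \<noteq> 0"
    using assms not_dvd_unit by (simp add: prime_dvd_mult_iff flip: dvd_eq_mod_eq_0)
  moreover have "0 \<le> m * k mod int p" "m * k mod int p < int p"
    using prime_gt_0_nat[OF assms(1)] by simp_all
  ultimately show ?thesis by simp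
qed

lemma mod_inverse_exists:
  assumes "prime p" "\<not> int p dvd m"
  shows "\<exists>k\<in>{1..<int p}. k * m mod int p = 1"
proof -
  have p1: "int p > 1" using prime_gt_1_nat[OF assms(1)] by simp
  have "coprime m (int p)"
    using assms prime_imp_coprime[of "int p" m] by (simp add: coprime_commute)
  then obtain k where k: "[m * k = 1] (mod int p)" using cong_solve_coprime_int by blast
  let ?k = "k mod int p"
  have "?k * m mod int p = k * m mod int p" by (rule mod_mult_left_eq)
  then have "?k * m mod int p = 1"
    using k p1 by (simp add: cong_def mult.commute)
  moreover from this have "?k \<noteq> 0" by auto
  moreover have "0 \<le> ?k" "?k < int p" using p1 by simp_all
  ultimately show ?thesis by (intro bexI[of _ ?k]) simp_all
qed

lemma group_affine_group:
  assumes "prime p"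
  shows "group (affine_group p)"
proof (rule groupI)
  have p1: "int p > 1" using prime_gt_1_nat[OF assms] by simp
  show "\<one>\<^bsub>affine_group p\<^esub> \<in> carrier (affine_group p)"
    using p1 by (simp add: affine_group_def)
  fix g h k
  assume g: "g \<in> carrier (affine_group p)" and h: "h \<in> carrier (affine_group p)"
    and k: "k \<in> carrier (affine_group p)"
  show "g \<otimes>\<^bsub>affine_group p\<^esub> h \<in> carrier (affine_group p)"
    using g h mult_mod_in_units[OF assms] p1 by (auto simp: affine_group_def)
  obtain m b m' b' m'' b'' where eqs: "g = (m, b)" "h = (m', b')" "k = (m'', b'')"
    by (metis surj_pair)
  have "(m * m' mod int p * b'' + (m * b' + b) mod int p) mod int p
      = (m * m' * b'' + (m * b' + b)) mod int p"
    by (rule mod_add_cong, rule mod_mult_cong) simp_all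
  moreover have "(m * ((m' * b'' + b') mod int p) + b) mod int p
      = (m * (m' * b'' + b') + b) mod int p"
    by (rule mod_add_cong, rule mod_mult_cong) simp_all
  ultimately show "g \<otimes>\<^bsub>affine_group p\<^esub> h \<otimes>\<^bsub>affine_group p\<^esub> k = g \<otimes>\<^bsub>affine_group p\<^esub> (h \<otimes>\<^bsub>affine_group p\<^esub> k)"
    by (simp add: affine_group_def eqs mod_mult_left_eq mod_mult_right_eq mult.assoc distrib_left add.assoc)
next
  fix g
  assume g: "g \<in> carrier (affine_group p)"
  then show "\<one>\<^bsub>affine_group p\<^esub> \<otimes>\<^bsub>affine_group p\<^esub> g = g"
    by (auto simp: affine_group_def)
  have p0: "int p > 0" using prime_gt_0_nat[OF assms] by simp
  obtain m b where mb: "g = (m, b)" "m \<in> {1..<int p}" using g by (auto simp: affine_group_def)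
  then obtain m' where m': "m' \<in> {1..<int p}" "m' * m mod int p = 1"
    using mod_inverse_exists[OF assms not_dvd_unit] by blast
  let ?h = "(m', - (m' * b) mod int p)"
  have "?h \<in> carrier (affine_group p)" using m' p0 by (simp add: affine_group_def)
  moreover have "?h \<otimes>\<^bsub>affine_group p\<^esub> g = \<one>\<^bsub>affine_group p\<^esub>"
    using m' by (simp add: affine_group_def mb mod_add_right_eq)
  ultimately show "\<exists>h\<in>carrier (affine_group p). h \<otimes>\<^bsub>affine_group p\<^esub> g = \<one>\<^bsub>affine_group p\<^esub>"
    by blast
qed

lemma inj_affine_mod:
  assumes "prime p" "m \<in> {1..<int p}"
  shows "inj_on (affine_mod p m b) {0..<int p}"
proof (rule inj_onI)
  fix x y
  assume xy: "x \<in> {0..<int p}" "y \<in> {0..<int p}" "affine_mod p m b x = affine_mod p m b y"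
  then have "int p dvd m * (x - y)"
    by (simp add: affine_mod_def mod_eq_dvd_iff right_diff_distrib)
  then have "int p dvd x - y"
    using not_dvd_unit[OF assms(2)] assms(1) by (simp add: prime_dvd_mult_iff)
  then have "x mod int p = y mod int p" by (simp add: mod_eq_dvd_iff)
  then show "x = y" using xy(1,2) by simp
qed

lemma affine_image_exponent_set:
  assumes "prime p" "m \<in> {1..<int p}" "S \<in> exponent_sets p n"
  shows "affine_mod p m b ` S \<in> exponent_sets p n"
proof -
  have "inj_on (affine_mod p m b) S"
    using assms(3) by (intro inj_on_subset[OF inj_affine_mod[OF assms(1,2)]]) (auto simp: exponent_sets_def)
  then have "card (affine_mod p m b ` S) = card S" by (rule card_image)
  then show ?thesis
    using assms(3) prime_gt_0_nat[OF assms(1)]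
    by (auto simp: exponent_sets_def affine_mod_def)
qed

lemma finite_exponent_sets: "finite (exponent_sets p n)"
  by (rule finite_subset[of _ "Pow {0..<int p}"]) (auto simp: exponent_sets_def)

lemma affine_mod_comp:
  "affine_mod p m b (affine_mod p m' b' x) = affine_mod p (m * m' mod int p) ((m * b' + b) mod int p) x"
proof -
  have "affine_mod p m b (affine_mod p m' b' x) = (m * (m' * x + b') + b) mod int p"
    unfolding affine_mod_def by (rule mod_add_cong, rule mod_mult_cong) simp_all
  also have "\<dots> = (m * m' * x + (m * b' + b)) mod int p" by (simp add: algebra_simps)
  also have "\<dots> = affine_mod p (m * m' mod int p) ((m * b' + b) mod int p) x"
    unfolding affine_mod_def by (rule mod_add_cong, rule mod_mult_cong) simp_all
  finally show ?thesis .
qed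

text \<open>
  Restricting the maps to \<open>exponent_sets p n\<close> makes them extensional, as the elements of \<open>BijGroup\<close>
  are.
\<close>

lemma group_action_affine:
  assumes p: "prime p"
  shows "group_action (affine_group p) (exponent_sets p n) (affine_action p n)"
proof -
  let ?E = "exponent_sets p n"
  interpret group "affine_group p" by (rule group_affine_group[OF p])
  have bij: "affine_action p n g \<in> Bij ?E" if g: "g \<in> carrier (affine_group p)" for g
  proof -
    obtain m b where mb: "g = (m, b)" "m \<in> {1..<int p}" using g by (auto simp: affine_group_def)
    have img: "affine_action p n g ` ?E \<subseteq> ?E"
      using affine_image_exponent_set[OF p mb(2)] by (auto simp: affine_action_def mb(1))
    have "inj_on (affine_action p n g) ?E"
    proof (rule inj_onI)
      fix S S'
      assume S: "S \<in> ?E" "S' \<in> ?E" "affine_action p n g S = affine_action p n g S'"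
      then have eq: "affine_mod p m b ` S = affine_mod p m b ` S'"
        by (simp add: affine_action_def mb(1))
      have "S \<subseteq> {0..<int p}" "S' \<subseteq> {0..<int p}" using S by (auto simp: exponent_sets_def)
      then show "S = S'"
        using eq by (rule iffD1[OF inj_on_image_eq_iff[OF inj_affine_mod[OF p mb(2)]]])
    qed
    moreover from this have "affine_action p n g ` ?E = ?E"
      using img by (intro endo_inj_surj finite_exponent_sets)
    ultimately show ?thesis
      by (auto simp: Bij_def bij_betw_def affine_action_def mb(1))
  qed
  have "affine_action p n (g \<otimes>\<^bsub>affine_group p\<^esub> h)
      = affine_action p n g \<otimes>\<^bsub>BijGroup ?E\<^esub> affine_action p n h"
    if gh: "g \<in> carrier (affine_group p)" "h \<in> carrier (affine_group p)" for g h
  proof -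
    obtain m b where mb: "g = (m, b)" "m \<in> {1..<int p}" using gh(1) by (auto simp: affine_group_def)
    obtain m' b' where mb': "h = (m', b')" "m' \<in> {1..<int p}" using gh(2) by (auto simp: affine_group_def)
    have "affine_action p n (g \<otimes>\<^bsub>affine_group p\<^esub> h) = compose ?E (affine_action p n g) (affine_action p n h)"
    proof
      fix S
      show "affine_action p n (g \<otimes>\<^bsub>affine_group p\<^esub> h) S = compose ?E (affine_action p n g) (affine_action p n h) S"
        using affine_image_exponent_set[OF p mb'(2), of S n b']
        by (cases "S \<in> ?E")
           (simp_all add: affine_action_def compose_def affine_group_def mb mb' image_image affine_mod_comp)
    qed
    then show ?thesis using bij gh by (simp add: BijGroup_def)
  qed
  then have "affine_action p n \<in> hom (affine_group p) (BijGroup ?E)"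
    using bij by (intro homI) (auto simp: BijGroup_def)
  then show ?thesis
    unfolding group_action_def group_hom_def group_hom_axioms_def
    by (simp add: group_BijGroup is_group)
qed

theorem admissible_cyclic_classes_eq:
  assumes p: "prime p" "CARD('n) < p" and n: "CARD('n) \<ge> 2"
  shows "(admissible_cyclic_classes p :: (complex ^ 'n ^ 'n) set set set set) =
    (\<lambda>S. subgroup_conj_class PGL (std_subgroup p S)) ` exponent_sets p CARD('n)"
proof -
  let ?X = "{H :: (complex ^ 'n ^ 'n) set set.
    admissible H \<and> cyclic_group (PGL\<lparr>carrier := H\<rparr>) \<and> card H = p}"
  have std: "std_subgroup p S \<in> ?X" if S: "S \<in> exponent_sets p CARD('n)" for S
  proof -
    have "PGL\<lparr>carrier := std_subgroup p S\<rparr> = subgroup_generated PGL {pgl (std_matrix p S :: complex ^ 'n ^ 'n)}"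
      by (simp add: subgroup_generated_def std_subgroup_def)
    then show ?thesis
      using admissible_std_subgroup[OF p n S] card_std_subgroup[OF p(1) S n] PGL.cyclic_group_generated
      by simp
  qed
  have "subgroup_conj_class PGL ` ?X \<subseteq> (\<lambda>S. subgroup_conj_class PGL (std_subgroup p S)) ` exponent_sets p CARD('n)"
  proof (rule image_subsetI)
    fix H
    assume H: "H \<in> ?X"
    then obtain S g where S: "S \<in> exponent_sets p CARD('n)" "g \<in> carrier PGL"
        "H = g <#\<^bsub>PGL\<^esub> std_subgroup p S #>\<^bsub>PGL\<^esub> inv\<^bsub>PGL\<^esub> g"
      using conjugate_to_std_subgroup[OF p] by blast
    have "subgroup H PGL" using H by (simp add: admissible_def)
    then have "subgroup_conj_class PGL (std_subgroup p S) = subgroup_conj_class PGL H"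
      using S by (subst PGL.subgroup_conj_class_eq_iff) (auto simp: subgroup_std)
    then show "subgroup_conj_class PGL H \<in> (\<lambda>S. subgroup_conj_class PGL (std_subgroup p S)) ` exponent_sets p CARD('n)"
      using S(1) by blast
  qed
  moreover have "(\<lambda>S. subgroup_conj_class PGL (std_subgroup p S)) ` exponent_sets p CARD('n) \<subseteq> subgroup_conj_class PGL ` ?X"
    using std by (intro image_subsetI imageI) blast
  ultimately show ?thesis unfolding admissible_cyclic_classes_def by blast
qed

text \<open>
  The class of the diagonal subgroup of \<open>S\<close> and the affine orbit of \<open>S\<close> determine each other.
\<close>

theorem card_admissible_cyclic_classes:
  assumes p: "prime p" "CARD('n) < p" and n: "CARD('n) \<ge> 2"
  shows "finite (admissible_cyclic_classes p :: (complex ^ 'n ^ 'n) set set set set)"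
    and "card (admissible_cyclic_classes p :: (complex ^ 'n ^ 'n) set set set set) =
      card (orbits (affine_group p) (exponent_sets p CARD('n)) (affine_action p CARD('n)))"
proof -
  let ?E = "exponent_sets p CARD('n)"
  interpret group_action "affine_group p" ?E "affine_action p CARD('n)"
    by (rule group_action_affine[OF p(1)])
  show "finite (admissible_cyclic_classes p :: (complex ^ 'n ^ 'n) set set set set)"
    unfolding admissible_cyclic_classes_eq[OF assms] by (intro finite_imageI finite_exponent_sets)
  let ?c = "\<lambda>S. subgroup_conj_class PGL (std_subgroup p S :: (complex ^ 'n ^ 'n) set set)"
  let ?o = "orbit (affine_group p) (affine_action p CARD('n))"
  have orbit: "S' \<in> ?o S \<longleftrightarrow> (\<exists>m\<in>{1..<int p}. \<exists>b\<in>{0..<int p}. S' = affine_mod p m b ` S)"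
    if S: "S \<in> ?E" for S S'
  proof
    assume "S' \<in> ?o S"
    then obtain m b where mb: "m \<in> {1..<int p}" "b \<in> {0..<int p}" "S' = affine_action p CARD('n) (m, b) S"
      by (auto simp: orbit_def affine_group_def)
    then have "S' = affine_mod p m b ` S"
      using S by (simp add: affine_action_def)
    then show "\<exists>m\<in>{1..<int p}. \<exists>b\<in>{0..<int p}. S' = affine_mod p m b ` S"
      using mb(1,2) by (intro bexI)
  next
    assume "\<exists>m\<in>{1..<int p}. \<exists>b\<in>{0..<int p}. S' = affine_mod p m b ` S"
    then obtain m b where mb: "m \<in> {1..<int p}" "b \<in> {0..<int p}" "S' = affine_mod p m b ` S" by blast
    then have "S' = affine_action p CARD('n) (m, b) S" using S by (simp add: affine_action_def)
    then show "S' \<in> ?o S"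
      unfolding orbit_def using mb by (intro CollectI exI[of _ "(m, b)"]) (simp add: affine_group_def)
  qed
  have "?c S = ?c S' \<longleftrightarrow> ?o S = ?o S'" if S: "S \<in> ?E" "S' \<in> ?E" for S S'
  proof
    assume "?c S = ?c S'"
    then have "S' \<in> ?o S"
      unfolding orbit[OF S(1)] using affine_image_if_conjugate[OF p(1) n S]
      by (auto simp: PGL.subgroup_conj_class_eq_iff subgroup_std)
    then show "?o S = ?o S'" using S by (simp add: orbit_eq_iff)
  next
    assume "?o S = ?o S'"
    then have "S' \<in> ?o S" using S by (simp add: orbit_eq_iff)
    then have "?c S' = ?c S"
      unfolding orbit[OF S(1)] using conjugate_if_affine_image[OF p(1) n S]
      by (auto simp: PGL.subgroup_conj_class_eq_iff subgroup_std)
    then show "?c S = ?c S'" ..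
  qed
  then have "card (?c ` ?E) = card (?o ` ?E)"
    by (rule card_image_eq_if_same_kernel)
  moreover have "?o ` ?E = orbits (affine_group p) ?E (affine_action p CARD('n))"
    by (auto simp: orbits_def)
  ultimately show "card (admissible_cyclic_classes p :: (complex ^ 'n ^ 'n) set set set set) =
      card (orbits (affine_group p) ?E (affine_action p CARD('n)))"
    by (simp add: admissible_cyclic_classes_eq[OF assms])
qed

section \<open>Counting the orbits with Burnside's lemma\<close>

text \<open>
  The equation says that \<open>g\<close> conjugates \<open>h\<close> to \<open>k\<close>, and then \<open>\<phi> g\<close> maps the fixed points of \<open>h\<close>
  bijectively to those of \<open>k\<close>.
\<close>

lemma (in group_action) card_invariants_conjugate:
  assumes g: "g \<in> carrier G" "h \<in> carrier G" "k \<in> carrier G" and eq: "g \<otimes> h = k \<otimes> g"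
  shows "card (invariants E \<phi> h) = card (invariants E \<phi> k)"
proof -
  interpret group_hom G "BijGroup E" \<phi> by (rule group_hom)
  have comp: "\<phi> (a \<otimes> b) x = \<phi> a (\<phi> b x)" if "a \<in> carrier G" "b \<in> carrier G" "x \<in> E" for a b x
    using composition_rule[OF that(3,1,2)] hom_mult[OF that(1,2)] by simp
  have swap: "\<phi> g (\<phi> h x) = \<phi> k (\<phi> g x)" if "x \<in> E" for x
    using comp[OF g(1,2) that] comp[OF g(3,1) that] eq by simp
  have "\<phi> g ` invariants E \<phi> h = invariants E \<phi> k"
  proof (intro equalityI subsetI)
    fix y assume "y \<in> \<phi> g ` invariants E \<phi> h"
    then obtain x where "x \<in> E" "\<phi> h x = x" "y = \<phi> g x" by (auto simp: invariants_def)
    then show "y \<in> invariants E \<phi> k"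
      using swap[of x] element_image[OF g(1), of x y] by (simp add: invariants_def)
  next
    fix y assume "y \<in> invariants E \<phi> k"
    then have y: "y \<in> E" "\<phi> k y = y" by (auto simp: invariants_def)
    then obtain x where x: "x \<in> E" "\<phi> g x = y"
      using surj_prop[OF g(1)] by (metis imageE)
    have "\<phi> g (\<phi> h x) = \<phi> g x" using swap[OF x(1)] x(2) y(2) by simp
    then have "\<phi> h x = x"
      using inj_onD[OF inj_prop[OF g(1)]] x(1) element_image[OF g(2) x(1) refl] by blast
    then show "y \<in> \<phi> g ` invariants E \<phi> h" using x by (auto simp: invariants_def)
  qed
  moreover have "inj_on (\<phi> g) (invariants E \<phi> h)"
    by (rule inj_on_subset[OF inj_prop[OF g(1)]]) (auto simp: invariants_def)
  ultimately show ?thesis by (metis card_image)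
qed

lemma card_eq_fiber_card_mult:
  assumes "finite D" "finite F" "h ` D \<subseteq> F" "\<And>S. S \<in> F \<Longrightarrow> card {x\<in>D. h x = S} = k"
  shows "card D = k * card F"
proof -
  have "D = (\<Union>S\<in>F. {x\<in>D. h x = S})" using assms(3) by auto
  then have "card D = card (\<Union>S\<in>F. {x\<in>D. h x = S})" by simp
  also have "\<dots> = (\<Sum>S\<in>F. card {x\<in>D. h x = S})"
    using assms(1,2) by (intro card_UN_disjoint) auto
  also have "\<dots> = k * card F" using assms(4) by simp
  finally show ?thesis .
qed

definition fixed_sets :: "nat \<Rightarrow> nat \<Rightarrow> int \<Rightarrow> int set set" where
  "fixed_sets p n m = {S\<in>exponent_sets p n. affine_mod p m 0 ` S = S}"

lemma finite_fixed_sets: "finite (fixed_sets p n m)"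
  unfolding fixed_sets_def using finite_exponent_sets by (rule finite_subset[rotated]) auto

lemma fixed_setsI:
  assumes "prime p" "m \<in> {1..<int p}" "S \<subseteq> {0..<int p}" "card S = n"
    and "\<And>x. x \<in> S \<Longrightarrow> m * x mod int p \<in> S"
  shows "S \<in> fixed_sets p n m"
proof -
  have "finite S" using assms(3) by (rule finite_subset) simp
  moreover have "affine_mod p m 0 ` S \<subseteq> S" using assms(5) by (auto simp: affine_mod_def)
  moreover have "inj_on (affine_mod p m 0) S"
    using inj_affine_mod[OF assms(1,2)] assms(3) by (rule inj_on_subset)
  ultimately have "affine_mod p m 0 ` S = S" by (rule endo_inj_surj)
  then show ?thesis using assms(3,4) by (simp add: fixed_sets_def exponent_sets_def)
qed

lemma fixed_setsD:
  assumes "S \<in> fixed_sets p n m"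
  shows "S \<subseteq> {0..<int p}" "card S = n" "finite S" "x \<in> S \<Longrightarrow> m * x mod int p \<in> S"
  using assms finite_exponent_set[of S p n]
  by (auto simp: fixed_sets_def exponent_sets_def affine_mod_def)

text \<open>
  Multiplication by \<open>m\<close> permutes the nonzero elements of \<open>S\<close>, so it does not change their product
  modulo \<open>p\<close>; on the other hand it multiplies the product by \<open>m\<close> once for each element.
\<close>

lemma power_card_if_fixed:
  assumes p: "prime p" and m: "m \<in> {1..<int p}" and S: "S \<in> fixed_sets p n m"
  shows "[m ^ card (S - {0}) = 1] (mod int p)"
proof -
  let ?f = "affine_mod p m 0" and ?S = "S - {0}"
  have sub: "S \<subseteq> {0..<int p}" and fS: "?f ` S = S"
    using S by (auto simp: fixed_sets_def exponent_sets_def)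
  have fin: "finite ?S" using fixed_setsD(3)[OF S] by simp
  have p0: "int p > 0" using prime_gt_0_nat[OF p] by simp
  have inj: "inj_on ?f {0..<int p}" by (rule inj_affine_mod[OF p m])
  have "?f ` ?S = ?f ` S - ?f ` {0}"
    using sub p0 by (intro inj_on_image_set_diff[OF inj]) auto
  moreover have "?f ` {0} = {0}" by (simp add: affine_mod_def)
  ultimately have f_image: "?f ` ?S = ?S" unfolding fS by (simp only:)
  have "(\<Prod>x\<in>?S. x) = (\<Prod>x\<in>?f ` ?S. x)" by (simp only: f_image)
  also have "\<dots> = (\<Prod>x\<in>?S. ?f x)"
    using inj_on_subset[OF inj, of ?S] sub by (subst prod.reindex) auto
  finally have "(\<Prod>x\<in>?S. x) = (\<Prod>x\<in>?S. ?f x)" .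
  moreover have "[(\<Prod>x\<in>?S. ?f x) = (\<Prod>x\<in>?S. m * x)] (mod int p)"
    by (rule cong_prod) (simp add: affine_mod_def cong_def)
  moreover have "(\<Prod>x\<in>?S. m * x) = m ^ card ?S * (\<Prod>x\<in>?S. x)"
    by (simp add: prod.distrib)
  ultimately have "[m ^ card ?S * (\<Prod>x\<in>?S. x) = 1 * (\<Prod>x\<in>?S. x)] (mod int p)"
    by (simp add: cong_sym)
  moreover have "\<not> int p dvd (\<Prod>x\<in>?S. x)"
  proof
    assume "int p dvd (\<Prod>x\<in>?S. x)"
    then obtain x where "x \<in> ?S" "int p dvd x"
      using prime_dvd_prod_iff[OF fin, of "int p" "\<lambda>x. x"] p by auto
    moreover have "x \<in> {1..<int p}" using \<open>x \<in> ?S\<close> sub by force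
    ultimately show False using not_dvd_unit by blast
  qed
  then have "coprime (\<Prod>x\<in>?S. x) (int p)"
    using p by (intro coprime_commute[THEN iffD1, OF prime_imp_coprime]) auto
  ultimately show ?thesis by (simp only: cong_mult_rcancel)
qed

text \<open>
  A translation by \<open>b\<close> changes the sum of the \<open>n\<close> elements by \<open>n b\<close>, which is not divisible by \<open>p\<close>.
\<close>

lemma not_fixed_by_translation:
  assumes p: "prime p" and b: "b \<in> {1..<int p}" and n: "0 < n" "n < p" and S: "S \<in> exponent_sets p n"
  shows "affine_mod p 1 b ` S \<noteq> S"
proof
  assume eq: "affine_mod p 1 b ` S = S"
  have "1 \<in> {1..<int p}" using prime_gt_1_nat[OF p] by simp
  then have "inj_on (affine_mod p 1 b) S"
    using S by (intro inj_on_subset[OF inj_affine_mod[OF p]]) (auto simp: exponent_sets_def)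
  then have "(\<Sum>x\<in>affine_mod p 1 b ` S. x) = (\<Sum>x\<in>S. affine_mod p 1 b x)"
    by (subst sum.reindex) auto
  then have "(\<Sum>x\<in>S. x) = (\<Sum>x\<in>S. affine_mod p 1 b x)" unfolding eq .
  moreover have "[(\<Sum>x\<in>S. affine_mod p 1 b x) = (\<Sum>x\<in>S. x + b)] (mod int p)"
    by (rule cong_sum) (simp add: affine_mod_def cong_def)
  moreover have "(\<Sum>x\<in>S. x + b) = (\<Sum>x\<in>S. x) + int n * b"
    using S by (simp add: sum.distrib exponent_sets_def)
  ultimately have "int p dvd int n * b"
    by (simp add: cong_iff_dvd_diff)
  then have "int p dvd int n"
    using p not_dvd_unit[OF b] by (simp add: prime_dvd_mult_iff)
  then show False using n by (auto dest: dvd_imp_le)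
qed

text \<open>
  For \<open>m \<noteq> 1\<close> the map \<open>x \<mapsto> m x + b\<close> has a fixed point \<open>c\<close>, and the translation by \<open>c\<close> conjugates
  \<open>x \<mapsto> m x\<close> to it.
\<close>

lemma card_invariants_multiplier:
  assumes p: "prime p" and m: "m \<in> {2..<int p}" and b: "b \<in> {0..<int p}"
  shows "card (invariants (exponent_sets p n) (affine_action p n) (m, b)) = card (fixed_sets p n m)"
proof -
  interpret group_action "affine_group p" "exponent_sets p n" "affine_action p n"
    by (rule group_action_affine[OF p])
  have p1: "int p > 1" using prime_gt_1_nat[OF p] by simp
  have "\<not> int p dvd m - 1" using m by (auto dest: zdvd_imp_le)
  then obtain k where k: "k * (m - 1) mod int p = 1"
    using mod_inverse_exists[OF p] by blast
  define c where "c = (- (k * b)) mod int p"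
  have "c = (m * c + b) mod int p"
  proof -
    have "[c = - (k * b)] (mod int p)" by (simp add: c_def cong_def)
    then have "[(m - 1) * c = (m - 1) * (- (k * b))] (mod int p)"
      by (rule cong_scalar_left)
    also have "(m - 1) * (- (k * b)) = - b * (k * (m - 1))" by (simp add: algebra_simps)
    also have "[- b * (k * (m - 1)) = - b * 1] (mod int p)"
      using k p1 by (intro cong_scalar_left) (simp add: cong_def)
    finally have "int p dvd (m - 1) * c + b" by (simp add: cong_iff_dvd_diff)
    then have "(m * c + b) mod int p = c mod int p"
      by (simp add: mod_eq_dvd_iff algebra_simps)
    then show ?thesis by (simp add: c_def)
  qed
  then have "(1, c) \<otimes>\<^bsub>affine_group p\<^esub> (m, 0) = (m, b) \<otimes>\<^bsub>affine_group p\<^esub> (1, c)"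
    using m p1 by (simp add: affine_group_def) (simp add: c_def)
  moreover have "(1, c) \<in> carrier (affine_group p)" "(m, 0) \<in> carrier (affine_group p)"
    "(m, b) \<in> carrier (affine_group p)"
    using m b p1 by (auto simp: affine_group_def c_def)
  ultimately have "card (invariants (exponent_sets p n) (affine_action p n) (m, 0)) =
      card (invariants (exponent_sets p n) (affine_action p n) (m, b))"
    by (intro card_invariants_conjugate)
  moreover have "invariants (exponent_sets p n) (affine_action p n) (m, 0) = fixed_sets p n m"
    by (auto simp: invariants_def affine_action_def fixed_sets_def)
  ultimately show ?thesis by simp
qed

text \<open>
  Each multiplier \<open>m \<noteq> 1\<close> occurs with \<open>p\<close> shifts, and these maps are all conjugate to \<open>x \<mapsto> m x\<close>. For
  \<open>m = 1\<close> only the identity contributes.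
\<close>

theorem burnside_affine:
  assumes p: "prime p" and n: "0 < n" "n < p"
  shows "card (orbits (affine_group p) (exponent_sets p n) (affine_action p n)) * ((p - 1) * p) =
    (p choose n) + p * (\<Sum>m\<in>{2..<int p}. card (fixed_sets p n m))"
proof -
  let ?E = "exponent_sets p n"
  interpret group_action "affine_group p" ?E "affine_action p n"
    by (rule group_action_affine[OF p])
  let ?I = "\<lambda>m b. card (invariants ?E (affine_action p n) (m, b))"
  have p1: "int p > 1" using prime_gt_1_nat[OF p] by simp
  have carrier: "carrier (affine_group p) = {1..<int p} \<times> {0..<int p}"
    by (simp add: affine_group_def)
  have "order (affine_group p) = (p - 1) * p"
    using p1 by (simp add: order_def carrier nat_diff_distrib)
  then have "card (orbits (affine_group p) ?E (affine_action p n)) * ((p - 1) * p) =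
      (\<Sum>g\<in>carrier (affine_group p). card (invariants ?E (affine_action p n) g))"
    using burnside finite_exponent_sets by (simp add: carrier)
  also have "\<dots> = (\<Sum>m\<in>{1..<int p}. \<Sum>b\<in>{0..<int p}. ?I m b)"
    unfolding carrier by (simp add: sum.cartesian_product)
  also have "{1..<int p} = insert 1 {2..<int p}" using p1 by auto
  also have "(\<Sum>m\<in>\<dots>. \<Sum>b\<in>{0..<int p}. ?I m b) =
      (\<Sum>b\<in>{0..<int p}. ?I 1 b) + (\<Sum>m\<in>{2..<int p}. \<Sum>b\<in>{0..<int p}. ?I m b)"
    by simp
  also have "(\<Sum>b\<in>{0..<int p}. ?I 1 b) = (p choose n)"
  proof -
    have "{0..<int p} = insert 0 {1..<int p}" using p1 by auto
    moreover have "?I 1 b = 0" if "b \<in> {1..<int p}" for b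
    proof -
      have "invariants ?E (affine_action p n) (1, b) = {}"
        using not_fixed_by_translation[OF p that n]
        by (auto simp: invariants_def affine_action_def)
      then show ?thesis by simp
    qed
    moreover have "invariants ?E (affine_action p n) (1, 0) = ?E"
    proof -
      have "affine_mod p 1 0 ` S = S" if "S \<in> ?E" for S
      proof -
        have "affine_mod p 1 0 x = x" if "x \<in> S" for x
          using \<open>S \<in> ?E\<close> that by (auto simp: affine_mod_def exponent_sets_def)
        then show ?thesis by simp
      qed
      then show ?thesis by (auto simp: invariants_def affine_action_def)
    qed
    moreover have "card ?E = (p choose n)"
      using n_subsets[of "{0..<int p}" n] by (simp add: exponent_sets_def)
    ultimately show ?thesis by simp
  qed
  also have "(\<Sum>m\<in>{2..<int p}. \<Sum>b\<in>{0..<int p}. ?I m b) = (\<Sum>m\<in>{2..<int p}. p * card (fixed_sets p n m))"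
    using card_invariants_multiplier[OF p] by (intro sum.cong) simp_all
  finally show ?thesis by (simp add: sum_distrib_left)
qed

definition units_of_order :: "nat \<Rightarrow> nat \<Rightarrow> int set" where
  "units_of_order p d = {m\<in>{1..<int p}. ord p (nat m) = d}"

lemma power_cong_1_iff_ord_dvd:
  assumes "m \<in> {1..<int p}"
  shows "[m ^ k = 1] (mod int p) \<longleftrightarrow> ord p (nat m) dvd k"
proof -
  have "[m ^ k = 1] (mod int p) \<longleftrightarrow> [int (nat m ^ k) = int 1] (mod int p)"
    using assms by simp
  also have "\<dots> \<longleftrightarrow> [nat m ^ k = 1] (mod p)" by (rule cong_int_iff)
  also have "\<dots> \<longleftrightarrow> ord p (nat m) dvd k" by (rule ord_divides)
  finally show ?thesis .
qed

lemma card_units_of_order: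
  assumes "prime p"
  shows "card (units_of_order p d) = (if d dvd p - 1 then totient d else 0)"
proof -
  have "units_of_order p d = int ` {x\<in>totatives p. ord p x = d}"
  proof (intro equalityI subsetI)
    fix m assume "m \<in> units_of_order p d"
    then have m: "m \<in> {1..<int p}" "ord p (nat m) = d" by (auto simp: units_of_order_def)
    then have "\<not> p dvd nat m" by (auto dest!: dvd_imp_le)
    then have "nat m \<in> totatives p"
      using m(1) assms prime_imp_coprime[of p "nat m"] by (auto simp: totatives_def coprime_commute)
    then show "m \<in> int ` {x\<in>totatives p. ord p x = d}"
      using m by (intro image_eqI[of _ _ "nat m"]) auto
  next
    fix m assume "m \<in> int ` {x\<in>totatives p. ord p x = d}"
    then obtain x where x: "m = int x" "x \<in> totatives p" "ord p x = d" by blast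
    have "x \<noteq> p" using x(2) prime_gt_1_nat[OF assms] by (auto simp: totatives_def)
    then show "m \<in> units_of_order p d"
      using x by (auto simp: units_of_order_def totatives_def)
  qed
  then show ?thesis
    using prime_card_elements_with_ord_eq_totient[OF prime_gt_1_nat[OF assms] assms, of d] assms
    by (simp add: card_image)
qed

text \<open>
  A fixed set has three or four nonzero elements, and \<open>d\<close> divides their number. So these elements form
  a single orbit \<open>C x\<close> of multiplication by \<open>m\<close>, and 0 belongs to the set exactly for \<open>d = 3\<close>. Each fixed
  set comes from \<open>d\<close> of the \<open>p - 1\<close> nonzero residues \<open>x\<close>.
\<close>

lemma card_fixed_sets_ord_3_4:
  assumes p: "prime p" and m: "m \<in> units_of_order p d" and d: "d = 3 \<or> d = 4"
  shows "d * card (fixed_sets p 4 m) = p - 1"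
proof -
  have mu: "m \<in> {1..<int p}" and ord: "ord p (nat m) = d"
    using m by (auto simp: units_of_order_def)
  have pow: "[m ^ k = 1] (mod int p) \<longleftrightarrow> d dvd k" for k
    using power_cong_1_iff_ord_dvd[OF mu] ord by simp
  have p0: "int p > 0" using prime_gt_0_nat[OF p] by simp
  define Z :: "int set" where "Z = (if d = 3 then {0} else {})"
  define C where "C x = (\<lambda>k. m ^ k * x mod int p) ` {..<d}" for x
  have C_units: "m ^ k * x mod int p \<in> {1..<int p}" if "x \<in> {1..<int p}" for k x
  proof -
    have "\<not> int p dvd m ^ k * x"
      using p not_dvd_unit[OF mu] not_dvd_unit[OF that] prime_dvd_power[of "int p" m k]
      by (auto simp: prime_dvd_mult_iff)
    then have "m ^ k * x mod int p \<noteq> 0" by (simp add: dvd_eq_mod_eq_0)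
    moreover have "0 \<le> m ^ k * x mod int p" "m ^ k * x mod int p < int p" using p0 by simp_all
    ultimately show ?thesis by simp
  qed
  have card_C: "card (C x) = d" if x: "x \<in> {1..<int p}" for x
  proof -
    have "m ^ i * x mod int p \<noteq> m ^ j * x mod int p" if "i < j" "j < d" for i j
    proof
      assume "m ^ i * x mod int p = m ^ j * x mod int p"
      then have "int p dvd m ^ j * x - m ^ i * x" by (metis mod_eq_dvd_iff)
      also have "m ^ j = m ^ i * m ^ (j - i)" using that by (simp flip: power_add)
      also have "m ^ i * m ^ (j - i) * x - m ^ i * x = m ^ i * x * (m ^ (j - i) - 1)"
        by (simp add: algebra_simps)
      finally have "int p dvd m ^ (j - i) - 1"
        using p not_dvd_unit[OF mu] not_dvd_unit[OF x] prime_dvd_power[of "int p" m i]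
        by (auto simp: prime_dvd_mult_iff)
      then have "d dvd j - i" by (simp add: cong_iff_dvd_diff flip: pow)
      then show False using that by (auto dest: dvd_imp_le)
    qed
    then have "inj_on (\<lambda>k. m ^ k * x mod int p) {..<d}"
      by (intro linorder_inj_onI) auto
    then show ?thesis by (simp add: C_def card_image)
  qed
  have closed: "m * y mod int p \<in> C x" if y: "y \<in> C x" for x y
  proof -
    obtain k where k: "k < d" "y = m ^ k * x mod int p" using y by (auto simp: C_def)
    have eq: "m * y mod int p = m ^ Suc k * x mod int p"
      by (simp add: k(2) mod_mult_right_eq mult.assoc)
    show ?thesis
    proof (cases "Suc k = d")
      case True
      have "[m ^ d * x = 1 * x] (mod int p)" using pow[of d] by (intro cong_scalar_right) simp
      then have "m * y mod int p = m ^ 0 * x mod int p"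
        using eq True by (simp add: cong_def)
      then show ?thesis unfolding C_def using d by (intro image_eqI[of _ _ 0]) auto
    next
      case False
      then show ?thesis using k(1) unfolding eq C_def by (intro imageI) simp
    qed
  qed
  have "card {1..<int p} = d * card (fixed_sets p 4 m)"
  proof (rule card_eq_fiber_card_mult[where h = "\<lambda>x. Z \<union> C x"])
    show "(\<lambda>x. Z \<union> C x) ` {1..<int p} \<subseteq> fixed_sets p 4 m"
    proof (rule image_subsetI)
      fix x assume x: "x \<in> {1..<int p}"
      have sub: "C x \<subseteq> {1..<int p}" using C_units[OF x] by (auto simp: C_def)
      have "Z \<inter> C x = {}" using sub by (auto simp: Z_def)
      then have "card (Z \<union> C x) = card Z + card (C x)"
        by (intro card_Un_disjoint) (auto simp: Z_def C_def)
      also have "\<dots> = 4" using card_C[OF x] d by (auto simp: Z_def)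
      finally show "Z \<union> C x \<in> fixed_sets p 4 m"
        using sub p0 closed[of _ x] by (intro fixed_setsI[OF p mu]) (auto simp: Z_def)
    qed
    fix S assume S: "S \<in> fixed_sets p 4 m"
    note S' = fixed_setsD[OF S]
    have "d dvd card (S - {0})"
      using power_card_if_fixed[OF p mu S] pow by simp
    moreover have "card (S - {0}) = (if 0 \<in> S then 3 else 4)"
      using S'(2,3) by simp
    ultimately have zero: "0 \<in> S \<longleftrightarrow> d = 3" and card_S: "card (S - {0}) = d"
      using d by (auto split: if_splits)
    have "{x\<in>{1..<int p}. Z \<union> C x = S} = S - {0}"
    proof (intro equalityI subsetI)
      fix x assume "x \<in> {x\<in>{1..<int p}. Z \<union> C x = S}"
      moreover from this have "x = m ^ 0 * x mod int p" by simp
      then have "x \<in> C x" unfolding C_def using d by (intro image_eqI[of _ _ 0]) auto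
      ultimately show "x \<in> S - {0}" by auto
    next
      fix x assume x: "x \<in> S - {0}"
      then have xu: "x \<in> {1..<int p}" using S'(1) by force
      have orbit: "m ^ k * x mod int p \<in> S" for k
      proof (induction k)
        case 0
        then show ?case using x xu by simp
      next
        case (Suc k)
        then have "m * (m ^ k * x mod int p) mod int p \<in> S" by (rule S'(4))
        then show ?case by (simp add: mod_mult_right_eq mult.assoc)
      qed
      have "C x \<subseteq> S - {0}"
        unfolding C_def
      proof (rule image_subsetI)
        fix k
        show "m ^ k * x mod int p \<in> S - {0}" using orbit[of k] C_units[OF xu, of k] by simp
      qed
      then have "C x = S - {0}"
        using card_C[OF xu] card_S S'(3) by (intro card_subset_eq) auto
      then have "Z \<union> C x = S" using zero by (auto simp: Z_def)
      then show "x \<in> {x\<in>{1..<int p}. Z \<union> C x = S}" using xu by simp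
    qed
    then show "card {x\<in>{1..<int p}. Z \<union> C x = S} = d" using card_S by simp
  qed (simp_all add: finite_fixed_sets)
  then show ?thesis by simp
qed

text \<open>
  Here \<open>m = - 1\<close>, and the number of nonzero elements of a fixed set must be even. So the fixed sets are
  \<open>{x, - x, y, - y}\<close>, each of which comes from 8 of the \<open>(p - 1) (p - 3)\<close> pairs \<open>(x, y)\<close>.
\<close>

lemma card_fixed_sets_ord_2:
  assumes p: "prime p" "p > 3" and m: "m \<in> units_of_order p 2"
  shows "8 * card (fixed_sets p 4 m) = (p - 1) * (p - 3)"
proof -
  have mu: "m \<in> {1..<int p}" and ord: "ord p (nat m) = 2"
    using m by (auto simp: units_of_order_def)
  have pow: "[m ^ k = 1] (mod int p) \<longleftrightarrow> 2 dvd k" for k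
    using power_cong_1_iff_ord_dvd[OF mu] ord by simp
  have "int p dvd m ^ 2 - 1" using pow[of 2] by (simp add: cong_iff_dvd_diff)
  also have "m ^ 2 - 1 = (m - 1) * (m + 1)" by (simp add: power2_eq_square algebra_simps)
  finally have "int p dvd m - 1 \<or> int p dvd m + 1" using p(1) by (simp add: prime_dvd_mult_iff)
  moreover have "\<not> int p dvd m - 1" using pow[of 1] by (simp add: cong_iff_dvd_diff)
  ultimately have "int p dvd m + 1" by blast
  then have "int p \<le> m + 1" using mu by (intro zdvd_imp_le) auto
  then have m_eq: "m = int p - 1" using mu by simp
  have neg: "m * x mod int p = int p - x" if x: "x \<in> {1..<int p}" for x
  proof -
    have "m * x = (int p - x) + (x - 1) * int p" by (simp add: m_eq algebra_simps)
    then have "m * x mod int p = (int p - x) mod int p" by (simp only: mod_mult_self1)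
    also have "\<dots> = int p - x" using x by (intro mod_pos_pos_trivial) auto
    finally show ?thesis .
  qed
  have "odd p" using p prime_odd_nat[of p] by simp
  then have no_fix: "int p - x \<noteq> x" for x by presburger
  have card_pairs: "card (Sigma X (\<lambda>x. X - {x, int p - x})) = card X * (card X - 2)"
    if "finite X" "\<And>x. x \<in> X \<Longrightarrow> int p - x \<in> X" for X
  proof -
    have "card (X - {x, int p - x}) = card X - 2" if "x \<in> X" for x
      using \<open>finite X\<close> \<open>x \<in> X\<close> \<open>\<And>x. x \<in> X \<Longrightarrow> int p - x \<in> X\<close>[of x] no_fix[of x]
      by (subst card_Diff_subset) auto
    then show ?thesis using \<open>finite X\<close> by simp
  qed
  let ?U = "{1..<int p}"
  let ?D = "Sigma ?U (\<lambda>x. ?U - {x, int p - x})"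
  let ?h = "\<lambda>(x, y). {x, int p - x, y, int p - y}"
  have card_h: "card (?h (x, y)) = 4" if "y \<noteq> x" "y \<noteq> int p - x" for x y
    using that no_fix[of x] no_fix[of y] by simp
  have "card ?D = 8 * card (fixed_sets p 4 m)"
  proof (rule card_eq_fiber_card_mult[where h = ?h])
    show "?h ` ?D \<subseteq> fixed_sets p 4 m"
    proof (rule image_subsetI)
      fix z assume "z \<in> ?D"
      moreover obtain x y where z: "z = (x, y)" by (cases z)
      ultimately have xy: "x \<in> ?U" "y \<in> ?U" "y \<noteq> x" "y \<noteq> int p - x" by auto
      show "?h z \<in> fixed_sets p 4 m"
        unfolding z using card_h[OF xy(3,4)] xy(1,2) neg[of x] neg[of y] neg[of "int p - x"] neg[of "int p - y"]
        by (intro fixed_setsI[OF p(1) mu]) auto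
    qed
    fix S assume S: "S \<in> fixed_sets p 4 m"
    note S' = fixed_setsD[OF S]
    have "2 dvd card (S - {0})"
      using power_card_if_fixed[OF p(1) mu S] pow by simp
    moreover have "card (S - {0}) = (if 0 \<in> S then 3 else 4)"
      using S'(2,3) by simp
    ultimately have "0 \<notin> S" by (auto split: if_splits)
    have SU: "S \<subseteq> ?U"
    proof
      fix x assume "x \<in> S"
      then have "x \<in> {0..<int p}" "x \<noteq> 0" using S'(1) \<open>0 \<notin> S\<close> by blast+
      then show "x \<in> ?U" by simp
    qed
    have S_neg: "int p - x \<in> S" if "x \<in> S" for x
      using S'(4)[OF that] neg[of x] SU that by auto
    have "{z\<in>?D. ?h z = S} = Sigma S (\<lambda>x. S - {x, int p - x})"
    proof (intro equalityI subsetI)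
      fix z assume "z \<in> Sigma S (\<lambda>x. S - {x, int p - x})"
      moreover obtain x y where z: "z = (x, y)" by (cases z)
      ultimately have xy: "x \<in> S" "y \<in> S" "y \<noteq> x" "y \<noteq> int p - x" by auto
      have "?h z \<subseteq> S" using z xy S_neg by simp
      then have "?h z = S"
        using card_h[OF xy(3,4)] S'(2,3) z by (intro card_subset_eq) simp_all
      moreover have "z \<in> ?D" using z xy SU by auto
      ultimately show "z \<in> {z\<in>?D. ?h z = S}" by simp
    qed auto
    then show "card {z\<in>?D. ?h z = S} = 8"
      using card_pairs[OF S'(3) S_neg] S'(2) by simp
  qed (simp_all add: finite_fixed_sets)
  moreover have "card ?D = card ?U * (card ?U - 2)"
    by (rule card_pairs) auto
  moreover have "card ?U = p - 1" using p(2) by (simp add: nat_diff_distrib)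
  ultimately have "8 * card (fixed_sets p 4 m) = (p - 1) * (p - 1 - 2)" by metis
  moreover have "p - 1 - 2 = p - 3" by simp
  ultimately show ?thesis by metis
qed

text \<open>
  A fixed set of four elements has three or four nonzero ones, so the order of \<open>m\<close> divides 3 or 4, and
  it is not 1 because \<open>m \<noteq> 1\<close>.
\<close>

lemma fixed_sets_empty:
  assumes "prime p" "m \<in> {2..<int p}" "ord p (nat m) \<notin> {2, 3, 4}"
  shows "fixed_sets p 4 m = {}"
proof (rule ccontr)
  assume "fixed_sets p 4 m \<noteq> {}"
  then obtain S where S: "S \<in> fixed_sets p 4 m" by blast
  have mu: "m \<in> {1..<int p}" using assms(2) by simp
  have "card (S - {0}) = (if 0 \<in> S then 3 else 4)"
    using fixed_setsD(2,3)[OF S] by simp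
  then have "ord p (nat m) dvd 3 \<or> ord p (nat m) dvd 4"
    using power_card_if_fixed[OF assms(1) mu S] power_cong_1_iff_ord_dvd[OF mu] by (metis (full_types))
  moreover have "ord p (nat m) \<noteq> 1"
  proof
    assume "ord p (nat m) = 1"
    then have "int p dvd m - 1"
      using power_cong_1_iff_ord_dvd[OF mu, of 1] by (simp add: cong_iff_dvd_diff)
    then show False using assms(2) by (auto dest: zdvd_imp_le)
  qed
  moreover have "k \<in> {1, 3}" if "k dvd 3" for k :: nat
  proof -
    have "k = 0 \<or> k = 1 \<or> k = 2 \<or> k = 3" using dvd_imp_le[OF that] by linarith
    then show ?thesis using that by auto
  qed
  moreover have "k \<in> {1, 2, 4}" if "k dvd 4" for k :: nat
  proof -
    have "k = 0 \<or> k = 1 \<or> k = 2 \<or> k = 3 \<or> k = 4" using dvd_imp_le[OF that] by linarith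
    then show ?thesis using that by auto
  qed
  ultimately show False using assms(3) by blast
qed

lemma sum_card_fixed_sets:
  assumes p: "prime p" "p > 3"
  shows "real (\<Sum>m\<in>{2..<int p}. card (fixed_sets p 4 m)) =
    (real p - 1) * (real p - 3) / 8 + (if 3 dvd p - 1 then 2 * (real p - 1) / 3 else 0)
      + (if 4 dvd p - 1 then (real p - 1) / 2 else 0)"
proof -
  let ?F = "\<lambda>m. card (fixed_sets p 4 m)" and ?U = "units_of_order p"
  have sub: "?U d \<subseteq> {2..<int p}" if "d \<noteq> 1" for d
  proof
    fix m assume m: "m \<in> ?U d"
    then have mu: "m \<in> {1..<int p}" and "ord p (nat m) = d" by (auto simp: units_of_order_def)
    moreover have "m \<noteq> 1" using \<open>ord p (nat m) = d\<close> that by auto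
    ultimately show "m \<in> {2..<int p}" by auto
  qed
  have fin: "finite (?U d)" for d
    by (rule finite_subset[of _ "{1..<int p}"]) (auto simp: units_of_order_def)
  have disj: "?U d \<inter> ?U e = {}" if "d \<noteq> e" for d e using that by (auto simp: units_of_order_def)
  have "(\<Sum>m\<in>{2..<int p}. ?F m) = (\<Sum>m\<in>?U 2 \<union> (?U 3 \<union> ?U 4). ?F m)"
  proof (rule sum.mono_neutral_right)
    show "?U 2 \<union> (?U 3 \<union> ?U 4) \<subseteq> {2..<int p}" using sub by simp
    show "\<forall>m\<in>{2..<int p} - (?U 2 \<union> (?U 3 \<union> ?U 4)). ?F m = 0"
      using fixed_sets_empty[OF p(1)] by (auto simp: units_of_order_def)
  qed simp
  also have "\<dots> = sum ?F (?U 2) + (sum ?F (?U 3) + sum ?F (?U 4))"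
    by (subst sum.union_disjoint; simp add: fin disj Int_Un_distrib)+
  finally have total: "(\<Sum>m\<in>{2..<int p}. ?F m) = sum ?F (?U 2) + (sum ?F (?U 3) + sum ?F (?U 4))" .
  have const: "real (sum ?F (?U d)) = real (card (?U d)) * c" if "\<And>m. m \<in> ?U d \<Longrightarrow> real (?F m) = c" for d c
    using that by simp
  have "odd p" using p prime_odd_nat[of p] by simp
  have "totient 3 = 2" by (simp add: totient_prime)
  have "totient 4 = 2" using totient_prime_power[of 2 2] by simp
  have p1: "real (p - 1) = real p - 1" "real (p - 3) = real p - 3" using p(2) by auto
  have "real (sum ?F (?U 2)) = 1 * ((real p - 1) * (real p - 3) / 8)"
  proof -
    have "card (?U 2) = 1" using card_units_of_order[OF p(1), of 2] \<open>odd p\<close> by simp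
    moreover have "real (?F m) = (real p - 1) * (real p - 3) / 8" if "m \<in> ?U 2" for m
      using arg_cong[OF card_fixed_sets_ord_2[OF p that], of real] p1 by simp
    ultimately show ?thesis using const[of 2 "(real p - 1) * (real p - 3) / 8"] by simp
  qed
  moreover have "real (sum ?F (?U 3)) = (if 3 dvd p - 1 then 2 * (real p - 1) / 3 else 0)"
  proof -
    have "real (?F m) = (real p - 1) / 3" if "m \<in> ?U 3" for m
      using arg_cong[OF card_fixed_sets_ord_3_4[OF p(1) that], of real] p1 by simp
    then have "real (sum ?F (?U 3)) = real (card (?U 3)) * ((real p - 1) / 3)"
      by (rule const)
    also have "\<dots> = (if 3 dvd p - 1 then 2 * (real p - 1) / 3 else 0)"
      by (simp add: card_units_of_order[OF p(1)] \<open>totient 3 = 2\<close>)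
    finally show ?thesis .
  qed
  moreover have "real (sum ?F (?U 4)) = (if 4 dvd p - 1 then (real p - 1) / 2 else 0)"
  proof -
    have "real (?F m) = (real p - 1) / 4" if "m \<in> ?U 4" for m
      using arg_cong[OF card_fixed_sets_ord_3_4[OF p(1) that], of real] p1 by simp
    then have "real (sum ?F (?U 4)) = real (card (?U 4)) * ((real p - 1) / 4)"
      by (rule const)
    also have "\<dots> = (if 4 dvd p - 1 then (real p - 1) / 2 else 0)"
      by (simp add: card_units_of_order[OF p(1)] \<open>totient 4 = 2\<close>)
    finally show ?thesis .
  qed
  ultimately show ?thesis using total by simp
qed

lemma card_affine_orbits_of_4_subsets:
  assumes p: "prime p" "p > 3"
  shows "real (card (orbits (affine_group p) (exponent_sets p 4) (affine_action p 4))) =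
    (real p - 2) * (real p - 3) / 24 + (real p - 3) / 8
      + (if p mod 3 = 1 then 2 / 3 else 0) + (if p mod 4 = 1 then 1 / 2 else 0)"
proof -
  let ?K = "card (orbits (affine_group p) (exponent_sets p 4) (affine_action p 4))"
  have "p > 4" using p by (cases "p = 4") auto
  have dvd: "3 dvd p - 1 \<longleftrightarrow> p mod 3 = 1" "4 dvd p - 1 \<longleftrightarrow> p mod 4 = 1"
    using p(2) by presburger+
  have p1: "real (p - 1) = real p - 1" using p(2) by auto
  have choose: "real (p choose 4) = real p * (real p - 1) * (real p - 2) * (real p - 3) / 24"
    using p(2) by (simp add: binomial_altdef_of_nat eval_nat_numeral of_nat_diff)
  have "real (?K * ((p - 1) * p)) =
      real (p choose 4) + real p * real (\<Sum>m\<in>{2..<int p}. card (fixed_sets p 4 m))"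
    using burnside_affine[OF p(1), of 4] \<open>p > 4\<close> by (metis of_nat_add of_nat_mult zero_less_numeral)
  then have "real ?K * ((real p - 1) * real p) =
      ((real p - 2) * (real p - 3) / 24 + (real p - 3) / 8
      + (if p mod 3 = 1 then 2 / 3 else 0) + (if p mod 4 = 1 then 1 / 2 else 0)) * ((real p - 1) * real p)"
    unfolding sum_card_fixed_sets[OF p] choose dvd using p1 by (auto simp: field_simps)
  moreover have "(real p - 1) * real p \<noteq> 0" using p(2) by simp
  ultimately show ?thesis using mult_right_cancel by blast
qed

theorem theorem2:
  fixes p :: nat and \<Phi> \<alpha> :: real
  assumes "prime p" and "p > 3"
    and "\<Phi> = (real p - 2) * (real p - 3)"
    and "\<alpha> = 3 * (real p - 3)"
  shows "let C = (admissible_cyclic_classes p :: (complex ^ 4 ^ 4) set set set set) in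
    finite C \<and>
    (p mod 4 \<noteq> 1 \<and> p mod 3 \<noteq> 1 \<longrightarrow>
       real (card C) = \<alpha> / 12 + (\<Phi> - \<alpha>) / 24) \<and>
    (p mod 4 \<noteq> 1 \<and> p mod 3 = 1 \<longrightarrow>
       real (card C) = 1 + \<alpha> / 12 + (\<Phi> - \<alpha> - 8) / 24) \<and>
    (p mod 4 = 1 \<and> p mod 3 \<noteq> 1 \<longrightarrow>
       real (card C) = 1 + (\<alpha> - 6) / 12 + (\<Phi> - \<alpha>) / 24) \<and>
    (p mod 4 = 1 \<and> p mod 3 = 1 \<longrightarrow>
       real (card C) = 2 + (\<alpha> - 6) / 12 + (\<Phi> - \<alpha> - 8) / 24)"
proof -
  let ?C = "admissible_cyclic_classes p :: (complex ^ 4 ^ 4) set set set set"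
  have four: "CARD(4) = 4" by simp
  have "p \<noteq> 4" using assms(1) by auto
  then have p: "CARD(4) < p" and n: "CARD(4) \<ge> 2" using assms(2) by simp_all
  have "finite ?C"
    by (rule card_admissible_cyclic_classes(1)[OF assms(1) p n])
  moreover have "real (card ?C) = (real p - 2) * (real p - 3) / 24 + (real p - 3) / 8
      + (if p mod 3 = 1 then 2 / 3 else 0) + (if p mod 4 = 1 then 1 / 2 else 0)"
    using card_affine_orbits_of_4_subsets[OF assms(1,2)]
    unfolding card_admissible_cyclic_classes(2)[OF assms(1) p n] four .
  ultimately show ?thesis
    unfolding Let_def assms(3,4)
    by (cases "p mod 3 = 1"; cases "p mod 4 = 1") (simp_all add: field_simps)
qed

end
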